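(* For every $\sigma\in(0,1)$ and every $\eta\in(-2\sqrt{\sigma},2\sqrt{\sigma})$, there exists a quadratic harness on $(0,\infty)$ with parameters $(\eta,\theta,\sigma,\tau,\gamma)$, where $\theta=-\eta$, $\tau=\sigma$ and $\gamma=1-2\sigma$.
   Context: A square-integrable process $(X_t)_{t\in T}$ on an open interval $T\subset(0,\infty)$ is a quadratic harness on $T$ with parameters $(\eta,\theta,\sigma,\tau,\gamma)$ if for all $s,t\in T$, $\mathbb{E}(X_t)=0$ and $\mathbb{E}(X_tX_s)=\min\{t,s\}$, and for all $s<t<u$ in $T$, with $\mathcal{F}_{s,u}$ the $\sigma$-field generated by $\{X_r: r\in T,\ r\le s\text{ or } r\ge u\}$, $$\mathbb{E}(X_t|\mathcal{F}_{s,u})=\frac{u-t}{u-s}X_s+\frac{t-s}{u-s}X_u,$$ $$\mathrm{Var}[X_t|\mathcal{F}_{s,u}]=\frac{(u-t)(t-s)}{u(1+\sigma s)+\tau-\gamma s}\Big(1+\eta\frac{uX_s-sX_u}{u-s}+\theta\frac{X_u-X_s}{u-s}+\sigma\frac{(uX_s-sX_u)^2}{(u-s)^2}+\tau\frac{(X_u-X_s)^2}{(u-s)^2}-(1-\gamma)\frac{(X_u-X_s)(uX_s-sX_u)}{(u-s)^2}\Big).$$ *)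

theory Defs
  imports "HOL-Probability.Probability"
begin

definition cond_variance :: "'a measure \<Rightarrow> 'a measure \<Rightarrow> ('a \<Rightarrow> real) \<Rightarrow> 'a \<Rightarrow> real" where
  "cond_variance M F f = real_cond_exp M F (\<lambda>\<omega>. (f \<omega> - real_cond_exp M F f \<omega>)\<^sup>2)"

definition outer_field :: "'a measure \<Rightarrow> real set \<Rightarrow> (real \<Rightarrow> 'a \<Rightarrow> real) \<Rightarrow> real \<Rightarrow> real \<Rightarrow> 'a measure" where
  "outer_field M T X s u =
     sigma (space M) {X r -` A \<inter> space M | r A. r \<in> T \<and> (r \<le> s \<or> r \<ge> u) \<and> A \<in> sets borel}"

text \<open>
  The process is given by a function on all of \<^typ>\<open>real\<close>, but only its values at times in
  \<open>T\<close> are constrained. Identities between conditional moments hold almost surely.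
\<close>

locale quadratic_harness = prob_space M
  for M :: "'a measure" and T :: "real set" and X :: "real \<Rightarrow> 'a \<Rightarrow> real"
    and \<eta> \<theta> \<sigma> \<tau> \<gamma> :: real +
  assumes open_interval: "open T" "is_interval T" "T \<noteq> {}" "T \<subseteq> {0<..}"
    and random_variable: "\<And>t. t \<in> T \<Longrightarrow> X t \<in> borel_measurable M"
    and square_integrable: "\<And>t. t \<in> T \<Longrightarrow> integrable M (\<lambda>\<omega>. (X t \<omega>)\<^sup>2)"
    and mean: "\<And>t. t \<in> T \<Longrightarrow> expectation (X t) = 0"
    and covariance: "\<And>s t. s \<in> T \<Longrightarrow> t \<in> T \<Longrightarrow> expectation (\<lambda>\<omega>. X t \<omega> * X s \<omega>) = min t s"
    and harness: "\<And>s t u. s \<in> T \<Longrightarrow> t \<in> T \<Longrightarrow> u \<in> T \<Longrightarrow> s < t \<Longrightarrow> t < u \<Longrightarrow>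
      AE \<omega> in M. real_cond_exp M (outer_field M T X s u) (X t) \<omega> =
        (u - t) / (u - s) * X s \<omega> + (t - s) / (u - s) * X u \<omega>"
    and quadratic: "\<And>s t u. s \<in> T \<Longrightarrow> t \<in> T \<Longrightarrow> u \<in> T \<Longrightarrow> s < t \<Longrightarrow> t < u \<Longrightarrow>
      AE \<omega> in M. cond_variance M (outer_field M T X s u) (X t) \<omega> =
        (u - t) * (t - s) / (u * (1 + \<sigma> * s) + \<tau> - \<gamma> * s) *
        (1 + \<eta> * ((u * X s \<omega> - s * X u \<omega>) / (u - s))
           + \<theta> * ((X u \<omega> - X s \<omega>) / (u - s))
           + \<sigma> * ((u * X s \<omega> - s * X u \<omega>)\<^sup>2 / (u - s)\<^sup>2)
           + \<tau> * ((X u \<omega> - X s \<omega>)\<^sup>2 / (u - s)\<^sup>2)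
           - (1 - \<gamma>) * ((X u \<omega> - X s \<omega>) * (u * X s \<omega> - s * X u \<omega>) / (u - s)\<^sup>2))"

end

theory Submission
  imports Defs
begin

text \<open>
  Put \<open>w\<^sub>t(x) = |\<Gamma>(t + ix)|\<^sup>2\<close>. Since \<open>w\<^sub>t / \<Gamma>(2t)\<close> is the Fourier transform of
  \<open>(2 cosh (v/2))\<^bsup>-2t\<^esup>\<close>, the functions \<open>w\<^sub>t / (2 \<pi> \<Gamma>(2t))\<close> form a convolution
  semigroup of positive densities (up to exponential factors, those of the Meixner process). Pinning
  the corresponding process at \<open>0\<close> at time \<open>0\<close> and at \<open>z\<close> at time \<open>T\<close> gives a Markov bridge, whose law
  is obtained from Kolmogorov's extension theorem. The recurrence
  \<open>w\<^bsub>t+1\<^esub>(x) = (t\<^sup>2 + x\<^sup>2) w\<^sub>t(x)\<close> turns the convolution identity into explicit first and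
  second moments: given its values at \<open>a < b\<close>, the bridge at \<open>t\<close> has linear conditional mean and a conditional
  variance that is quadratic in the increment over \<open>[a, b]\<close>. Centring the bridge \<open>Y\<close>, the process
  \<open>X\<^sub>t = c (1 + t) (Y(r) - r z / T)\<close> with \<open>r = T t / (1 + t)\<close> and
  \<open>c\<^sup>2 = (2 T + 1) / (T\<^sup>2 + z\<^sup>2)\<close> is a quadratic harness on \<open>(0, \<infinity>)\<close> with
  \<open>\<sigma> = 1 / (2 T + 1)\<close> and \<open>\<eta> = -2 z c \<sigma>\<close>, and the choice of \<open>T\<close> and \<open>z\<close> realises all admissible
  \<open>(\<sigma>, \<eta>)\<close>.
\<close>

text \<open>Pinning cancels the exponential tilts that distinguish the Meixner laws, so
  \<open>z\<close> is the only source of asymmetry. With c as above, \<eta> / (2 sqrt \<sigma>) = -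
  z / sqrt (T^2 + z^2), which runs through (-1, 1) as z runs through the reals. This is the origin
  of the bound on \<eta>, just as \<sigma> = 1 / (2 T + 1) fills (0, 1) for T > 0. The weights are
  suitable because the recurrence turns multiplication by x^2 into a shift of the index, and the
  convolution with a shifted index is explicit again: second moments of the bridge become algebra.
  The obstacle is that the conditioning field is generated by uncountably many coordinates, whereas
  densities are explicit for finitely many times only. Hence one identity for the insertion of a
  single time is proved for general nonnegative integrands. It serves the consistency of the
  marginals, integrability and the conditional moments alike, and the uniqueness of finite measures
  on infinite products carries it to the whole outer field.\<close>

section \<open>Fourier inversion\<close>

text \<open>Gaussian summation: insert the factor \<open>\<phi>(e\<^sub>n x)\<close>, exchange the integrals, and let \<open>e\<^sub>n\<close> tend to \<open>0\<close>.\<close>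

lemma fourier_inversion:
  fixes f :: "real \<Rightarrow> real" and g :: "real \<Rightarrow> complex"
  assumes cont: "continuous_on UNIV f" and int: "integrable lborel f" and bound: "\<And>x. \<bar>f x\<bar> \<le> C"
    and g: "\<And>x. (LINT v|lborel. iexp (x * v) * of_real (f v)) = g x"
    and intg: "integrable lborel g"
  shows "(LINT x|lborel. iexp (- (x * v)) * g x) = of_real (2 * pi * f v)"
proof -
  let ?\<phi> = std_normal_density
  define e :: "nat \<Rightarrow> real" where "e n = 1 / real (Suc n)" for n
  have e0: "e n > 0" for n by (simp add: e_def)
  have e_lim: "e \<longlonglongrightarrow> 0"
    unfolding e_def using LIMSEQ_inverse_real_of_nat by (simp add: inverse_eq_divide)
  have [measurable]: "f \<in> borel_measurable borel" "g \<in> borel_measurable borel"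
    using cont intg by (auto intro: borel_measurable_continuous_onI)
  define B where "B n = (LINT x|lborel. iexp (- (x * v)) * g x * of_real (?\<phi> (e n * x)))" for n
  have phi_bound: "\<bar>?\<phi> x\<bar> \<le> 1" for x
  proof -
    have "1 \<le> sqrt (2 * pi)" using pi_gt3 by simp
    then have "1 / sqrt (2 * pi) \<le> 1" by simp
    then have "1 / sqrt (2 * pi) * exp (- x\<^sup>2 / 2) \<le> 1 * 1" by (intro mult_mono) auto
    then show ?thesis by (simp add: std_normal_density_def)
  qed
  have phi_lim: "(\<lambda>n. ?\<phi> (e n * x)) \<longlonglongrightarrow> 1 / sqrt (2 * pi)" for x
    unfolding std_normal_density_def by (auto intro!: tendsto_eq_intros e_lim)
  have "B \<longlonglongrightarrow> (LINT x|lborel. iexp (- (x * v)) * g x * of_real (1 / sqrt (2 * pi)))"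
    unfolding B_def
  proof (rule integral_dominated_convergence[where w="\<lambda>x. norm (g x)"])
    show "AE x in lborel. (\<lambda>n. iexp (- (x * v)) * g x * of_real (?\<phi> (e n * x))) \<longlonglongrightarrow> iexp (- (x * v)) * g x * of_real (1 / sqrt (2 * pi))"
      by (intro AE_I2 tendsto_intros phi_lim)
    show "AE x in lborel. norm (iexp (- (x * v)) * g x * of_real (?\<phi> (e n * x))) \<le> norm (g x)" for n
      using phi_bound by (intro AE_I2) (simp add: norm_mult mult_left_le)
    show "integrable lborel (\<lambda>x. norm (g x))" using intg by simp
  qed measurable
  \<comment> \<open>The Gaussian is its own transform: after the exchange, the inner integral is the
    characteristic function of the normal law, so \<open>B n\<close> averages \<open>f\<close>
    around \<open>v\<close> on the scale \<open>e n\<close>. Two factors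
    \<open>sqrt (2 * pi)\<close>, one from each evaluation of the limit, make up the
    \<open>2 * pi\<close>.\<close>
  moreover have "B \<longlonglongrightarrow> of_real (sqrt (2 * pi) * f v)"
  proof -
    have intphi: "integrable lborel ?\<phi>" by simp
    have B: "B n = of_real (sqrt (2 * pi) * (LINT s|lborel. f (v + e n * s) * ?\<phi> s))" for n
    proof -
      define F where "F x y = iexp (x * (y - v)) * of_real (?\<phi> (e n * x) * f y)" for x y
      have intF: "integrable (lborel \<Otimes>\<^sub>M lborel) (case_prod F)"
      proof (rule lborel_pair.Fubini_integrable)
        show "case_prod F \<in> borel_measurable (lborel \<Otimes>\<^sub>M lborel)"
          unfolding F_def case_prod_beta by measurable
        have "integrable lborel (\<lambda>x. ?\<phi> (e n * x) * (LINT y|lborel. \<bar>f y\<bar>))"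
          using lborel_integrable_real_affine[OF intphi, of "e n" 0] e0[of n] by (intro integrable_mult_left) simp
        then show "integrable lborel (\<lambda>x. LINT y|lborel. norm (case (x, y) of (x, y) \<Rightarrow> F x y))"
          by (simp add: F_def norm_mult abs_mult)
        show "AE x in lborel. integrable lborel (\<lambda>y. case (x, y) of (x, y) \<Rightarrow> F x y)"
        proof (rule AE_I2)
          fix x :: real
          have "integrable lborel (\<lambda>y. F x y)"
            by (rule Bochner_Integration.integrable_bound[of _ "\<lambda>y. ?\<phi> (e n * x) * f y"])
              (auto simp: F_def norm_mult int)
          then show "integrable lborel (\<lambda>y. case (x, y) of (x, y) \<Rightarrow> F x y)" by simp
        qed
      qed
      have "B n = (LINT x|lborel. LINT y|lborel. F x y)"
        unfolding B_def g[symmetric] F_def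
        by (intro Bochner_Integration.integral_cong refl)
          (simp add: integral_mult_right_zero[symmetric] integral_mult_left_zero[symmetric] right_diff_distrib exp_diff exp_minus field_simps
            del: integral_mult_right_zero integral_mult_left_zero)
      also have "\<dots> = (LINT y|lborel. LINT x|lborel. F x y)"
        by (rule lborel_pair.Fubini_integral[OF intF, symmetric])
      also have "\<dots> = (LINT y|lborel. of_real (exp (- ((y - v) / e n)\<^sup>2 / 2) / e n * f y))"
      proof (intro Bochner_Integration.integral_cong refl)
        fix y :: real
        have "(LINT x|lborel. iexp (x * (y - v)) * of_real (?\<phi> (e n * x))) =
            \<bar>1 / e n\<bar> *\<^sub>R (LINT x|lborel. iexp ((0 + 1 / e n * x) * (y - v)) * of_real (?\<phi> (e n * (0 + 1 / e n * x))))"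
          by (rule lborel_integral_real_affine) (use e0[of n] in auto)
        also have "(LINT x|lborel. iexp ((0 + 1 / e n * x) * (y - v)) * of_real (?\<phi> (e n * (0 + 1 / e n * x)))) =
            (LINT x|lborel. ?\<phi> x *\<^sub>R iexp ((y - v) / e n * x))"
          using e0[of n] by (intro Bochner_Integration.integral_cong refl) (simp add: scaleR_conv_of_real mult_ac)
        also have "\<dots> = char std_normal_distribution ((y - v) / e n)"
          unfolding char_def
          by (subst integral_density) (auto simp: normal_density_nonneg)
        finally have "(LINT x|lborel. iexp (x * (y - v)) * of_real (?\<phi> (e n * x))) = of_real (exp (- ((y - v) / e n)\<^sup>2 / 2) / e n)"
          using e0[of n] by (simp add: char_std_normal_distribution scaleR_conv_of_real)
        then show "(LINT x|lborel. F x y) = of_real (exp (- ((y - v) / e n)\<^sup>2 / 2) / e n * f y)"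
          by (simp add: F_def mult.assoc[symmetric])
      qed
      also have "\<dots> = of_real (LINT y|lborel. exp (- ((y - v) / e n)\<^sup>2 / 2) / e n * f y)"
        by (rule integral_complex_of_real)
      also have "(LINT y|lborel. exp (- ((y - v) / e n)\<^sup>2 / 2) / e n * f y) =
          \<bar>e n\<bar> *\<^sub>R (LINT s|lborel. exp (- (((v + e n * s) - v) / e n)\<^sup>2 / 2) / e n * f (v + e n * s))"
        by (rule lborel_integral_real_affine) (use e0[of n] in auto)
      also have "\<dots> = (LINT s|lborel. exp (- s\<^sup>2 / 2) * f (v + e n * s))"
        using e0[of n] by (simp add: integral_mult_right_zero[symmetric] del: integral_mult_right_zero integral_mult_left_zero integral_divide_zero)
      also have "\<dots> = (LINT s|lborel. sqrt (2 * pi) * (f (v + e n * s) * ?\<phi> s))"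
        by (intro Bochner_Integration.integral_cong refl) (simp add: std_normal_density_def)
      finally show ?thesis by simp
    qed
    have "(\<lambda>n. LINT s|lborel. f (v + e n * s) * ?\<phi> s) \<longlonglongrightarrow> (LINT s|lborel. f v * ?\<phi> s)"
    proof (rule integral_dominated_convergence[where w="\<lambda>s. C * ?\<phi> s"])
      have "(\<lambda>n. f (v + e n * s)) \<longlonglongrightarrow> f v" for s
      proof -
        have "(\<lambda>n. v + e n * s) \<longlonglongrightarrow> v" by (auto intro!: tendsto_eq_intros e_lim)
        moreover have "isCont f v" using cont by (simp add: continuous_on_eq_continuous_at)
        ultimately show ?thesis by (rule isCont_tendsto_compose[rotated])
      qed
      then show "AE s in lborel. (\<lambda>n. f (v + e n * s) * ?\<phi> s) \<longlonglongrightarrow> f v * ?\<phi> s"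
        by (intro AE_I2 tendsto_intros)
      show "AE s in lborel. norm (f (v + e n * s) * ?\<phi> s) \<le> C * ?\<phi> s" for n
        using bound by (auto simp: abs_mult intro!: mult_right_mono)
    qed auto
    then have "(\<lambda>n. LINT s|lborel. f (v + e n * s) * ?\<phi> s) \<longlonglongrightarrow> f v"
      by simp
    then show ?thesis unfolding B[abs_def] by (intro tendsto_intros)
  qed
  ultimately have "(LINT x|lborel. iexp (- (x * v)) * g x * of_real (1 / sqrt (2 * pi))) = of_real (sqrt (2 * pi) * f v)"
    by (rule LIMSEQ_unique)
  then have "(LINT x|lborel. iexp (- (x * v)) * g x) = of_real (sqrt (2 * pi) * f v) * of_real (sqrt (2 * pi))"
    by (simp add: field_simps)
  also have "\<dots> = of_real (sqrt (2 * pi) * sqrt (2 * pi) * f v)" by (simp only: of_real_mult mult_ac)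
  finally show ?thesis by simp
qed

section \<open>The Fourier transform of powers of the hyperbolic secant\<close>

text \<open>Euler's integral after the substitution \<open>t = exp v\<close>. On the whole line the
  imaginary part of \<open>z\<close> becomes a phase and scaling becomes translation, as needed for
  a product of two Gamma values.\<close>

lemma Gamma_integral_exp:
  assumes "Re z > 0"
  shows "has_bochner_integral lborel (\<lambda>v::real. exp (z * of_real v - of_real (exp v))) (Gamma z)"
proof -
  let ?f = "\<lambda>t::real. complex_of_real t powr (z - 1) / of_real (exp t)"
  have img: "(exp :: real \<Rightarrow> real) ` UNIV = {0<..}"
  proof (intro equalityI subsetI)
    fix y :: real assume "y \<in> {0<..}"
    then have "exp (ln y) = y" by simp
    then show "y \<in> range exp" by (metis rangeI)
  qed auto
  have eq: "\<bar>exp v\<bar> *\<^sub>R ?f (exp v) = exp (z * of_real v - of_real (exp v))" for v :: real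
  proof -
    have "complex_of_real (exp v) powr (z - 1) = exp ((z - 1) * of_real v)"
      by (simp add: powr_def Ln_of_real)
    then have "\<bar>exp v\<bar> *\<^sub>R ?f (exp v) = exp (of_real v) * exp ((z - 1) * of_real v) * exp (- of_real (exp v))"
      by (simp only: scaleR_conv_of_real exp_of_real[symmetric] abs_exp_cancel exp_minus divide_inverse mult.assoc)
    also have "\<dots> = exp (z * of_real v - of_real (exp v))"
      unfolding exp_add[symmetric] by (rule arg_cong[where f=exp]) (simp add: algebra_simps)
    finally show ?thesis .
  qed
  have "?f absolutely_integrable_on (range exp) \<and> integral (range exp) ?f = Gamma z"
    unfolding img using absolutely_integrable_Gamma_integral'[OF assms] Gamma_integral_complex'[OF assms]
    by (auto simp: integral_unique)
  then have *: "(\<lambda>v. \<bar>exp v\<bar> *\<^sub>R ?f (exp v)) absolutely_integrable_on UNIV \<and>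
      integral UNIV (\<lambda>v. \<bar>exp v\<bar> *\<^sub>R ?f (exp v)) = Gamma z"
    by (subst has_absolute_integral_change_of_variables_real)
       (auto intro!: derivative_eq_intros simp: inj_on_def)
  define h where "h = (\<lambda>v::real. exp (z * of_real v - of_real (exp v)))"
  have m: "h \<in> borel_measurable lborel"
    unfolding h_def by measurable
  have "integrable lebesgue h" and i: "integral UNIV h = Gamma z"
    using * unfolding eq h_def[symmetric] by (simp_all add: set_integrable_def)
  then have "integrable lborel h"
    using m by (simp add: integrable_completion)
  then show ?thesis
    using i integral_lborel[of h] by (simp add: has_bochner_integral_iff h_def)
qed

lemma Gamma_integral_exp_scaled:
  assumes "Re z > 0"
  shows "has_bochner_integral lborel (\<lambda>v::real. exp (z * of_real v - of_real (exp (b + v))))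
          (exp (- z * of_real b) * Gamma z)"
proof -
  have "has_bochner_integral lborel
      (\<lambda>v::real. exp (- z * of_real b) * exp (z * of_real (b + 1 * v) - of_real (exp (b + 1 * v))))
      (exp (- z * of_real b) * Gamma z)"
    using Gamma_integral_exp[OF assms]
    by (subst (asm) lborel_has_bochner_integral_real_affine_iff[of 1 _ _ b])
       (auto intro!: has_bochner_integral_mult_right)
  then show ?thesis
    unfolding mult_exp_exp by (rule back_subst[where P="\<lambda>f. has_bochner_integral lborel f _"])
      (intro ext arg_cong[where f=exp], simp add: algebra_simps)
qed

section \<open>The kernel (2 cosh (v/2))^(-2t) and its transform\<close>

definition sech_kernel :: "real \<Rightarrow> real \<Rightarrow> real" where
  "sech_kernel t v = (exp (v / 2) + exp (- v / 2)) powr (- 2 * t)"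

definition meixner_weight :: "real \<Rightarrow> real \<Rightarrow> real" where
  "meixner_weight t x = (cmod (Gamma (Complex t x)))\<^sup>2"

lemma sech_kernel_pos: "sech_kernel t v > 0"
proof -
  have "exp (v / 2) + exp (- v / 2) > 0" by (intro add_pos_pos exp_gt_zero)
  then show ?thesis by (simp add: sech_kernel_def)
qed

lemma sech_kernel_add: "sech_kernel (s + t) v = sech_kernel s v * sech_kernel t v"
  by (simp add: sech_kernel_def powr_add[symmetric] algebra_simps)

lemma continuous_sech_kernel: "continuous_on UNIV (sech_kernel t)"
proof -
  have "exp (v / 2) + exp (- v / 2) \<noteq> 0" for v :: real
    using add_pos_pos[OF exp_gt_zero[of "v/2"] exp_gt_zero[of "-v/2"]] by linarith
  then show ?thesis
    unfolding sech_kernel_def by (intro continuous_intros) auto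
qed

lemma measurable_sech_kernel [measurable]: "sech_kernel t \<in> borel_measurable borel"
  by (intro borel_measurable_continuous_onI continuous_sech_kernel)

lemma sech_kernel_le_1:
  assumes "t > 0" shows "sech_kernel t v \<le> 1"
proof -
  have "1 \<le> exp (v / 2) + exp (- v / 2)"
  proof (cases "v \<ge> 0")
    case True
    then show ?thesis using exp_ge_zero[of "-v/2"] one_le_exp_iff[of "v/2"] by linarith
  next
    case False
    then show ?thesis using exp_ge_zero[of "v/2"] one_le_exp_iff[of "-v/2"] by linarith
  qed
  then show ?thesis
    unfolding sech_kernel_def using assms by (simp add: powr_minus ge_one_powr_ge_zero inverse_le_1_iff)
qed

lemma Gamma_times_Gamma_cnj: "Gamma z * Gamma (cnj z) = of_real ((cmod (Gamma z))\<^sup>2)"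
  by (metis cnj_Gamma complex_norm_square)

text \<open>One double integral is evaluated in both orders: over \<open>v\<close> first it gives
  Gamma(t + ix) Gamma(t - ix), over \<open>r\<close> first it gives the transform of the kernel
  times \<open>Gamma (2 * t)\<close>. Integrability of the kernel comes from the same integrand at
  \<open>y = 0\<close>, as a partial integral.\<close>

lemma
  assumes t: "t > 0"
  shows sech_kernel_integrable: "integrable lborel (sech_kernel t)"
    and sech_kernel_fourier:
      "(LINT v|lborel. iexp (x * v) * of_real (sech_kernel t v)) = of_real (meixner_weight t x / Gamma (2 * t))"
proof -
  \<comment> \<open>\<open>F y\<close> is the integrand of the double integral for \<open>\<Gamma>(t + iy) \<Gamma>(t - iy)\<close> after substituting \<open>r + v\<close> for the first variable.\<close>
  define F where "F y r v = exp (Complex t y * of_real v + of_real (2 * t * r - exp r) - of_real (exp (r + v)))"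
    for y r v :: real
  have meas: "case_prod (F y) \<in> borel_measurable (lborel \<Otimes>\<^sub>M lborel)" for y
    unfolding F_def case_prod_beta by measurable
  have inner_v: "has_bochner_integral lborel (F y r)
      (exp (Complex t (-y) * of_real r - of_real (exp r)) * Gamma (Complex t y))" for y r
  proof -
    have "has_bochner_integral lborel (\<lambda>v. exp (of_real (2 * t * r - exp r)) *
        exp (Complex t y * of_real v - of_real (exp (r + v))))
        (exp (of_real (2 * t * r - exp r)) * (exp (- Complex t y * of_real r) * Gamma (Complex t y)))"
      by (intro has_bochner_integral_mult_right Gamma_integral_exp_scaled) (use t in simp)
    moreover have "exp (of_real (2 * t * r - exp r)) * (exp (- Complex t y * of_real r)) =
        exp (Complex t (-y) * of_real r - of_real (exp r))"
      unfolding exp_add[symmetric] by (rule arg_cong[where f=exp]) (simp add: complex_eq_iff)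
    ultimately show ?thesis
      unfolding F_def mult.assoc[symmetric] mult_exp_exp by (simp add: algebra_simps)
  qed
  \<comment> \<open>The parameter \<open>y\<close> enters only through a phase, so absolute
    integrability for every \<open>y\<close> reduces to the real case \<open>y = 0\<close>.\<close>
  have normF: "complex_of_real (cmod (F y r v)) = F 0 r v" for y r v
    by (simp add: F_def exp_eq_polar complex_eq_iff norm_mult)
  have norm_inner: "(LINT v|lborel. cmod (F y r v)) = Re (exp (of_real t * of_real r - of_real (exp r)) * Gamma (of_real t))" for y r
  proof -
    have "complex_of_real (LINT v|lborel. cmod (F y r v)) = (LINT v|lborel. F 0 r v)"
      by (simp add: normF integral_complex_of_real[symmetric] del: integral_complex_of_real)
    also have "\<dots> = exp (of_real t * of_real r - of_real (exp r)) * Gamma (of_real t)"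
      using inner_v[of 0 r] by (simp add: has_bochner_integral_iff complex_of_real_def)
    finally show ?thesis by (metis Re_complex_of_real)
  qed
  have intF: "integrable (lborel \<Otimes>\<^sub>M lborel) (case_prod (F y))" for y
  proof (rule lborel_pair.Fubini_integrable[OF meas])
    have "integrable lborel (\<lambda>r. exp (of_real t * of_real r - of_real (exp r)) * Gamma (complex_of_real t))"
      using Gamma_integral_exp[of "of_real t"] t by (intro integrable_mult_left) (auto simp: has_bochner_integral_iff)
    then show "integrable lborel (\<lambda>r. LINT v|lborel. cmod (case (r, v) of (r, v) \<Rightarrow> F y r v))"
      by (simp only: norm_inner prod.case integrable_Re)
    show "AE r in lborel. integrable lborel (\<lambda>v. case (r, v) of (r, v) \<Rightarrow> F y r v)"
      using inner_v by (auto simp: has_bochner_integral_iff)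
  qed
  have inner_r: "(LINT r|lborel. F y r v) = iexp (y * v) * of_real (sech_kernel t v) * of_real (Gamma (2 * t))" for y v
  proof -
    \<comment> \<open>The sum \<open>exp r + exp (r + v)\<close> is merged into the single
      exponential \<open>exp (?b + r)\<close>, which makes the integral over \<open>r\<close> a
      shifted Gamma integral with argument \<open>2 * t\<close>.\<close>
    let ?b = "ln (1 + exp v)"
    have b: "exp (?b) = 1 + exp v" by (simp add: add_pos_pos)
    have A: "has_bochner_integral lborel (\<lambda>r. exp (Complex t y * of_real v) * exp (of_real (2*t) * of_real r - of_real (exp (?b + r))))
       (exp (Complex t y * of_real v) * (exp (- of_real (2*t) * of_real ?b) * Gamma (of_real (2 * t))))"
      by (intro has_bochner_integral_mult_right Gamma_integral_exp_scaled) (use t in simp)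
    have B: "exp (Complex t y * of_real v) * exp (of_real (2*t) * of_real r - of_real (exp (?b + r))) = F y r v" for r
      unfolding F_def exp_add[of ?b] b unfolding exp_add[symmetric]
      by (rule arg_cong[where f=exp]) (simp add: exp_add algebra_simps)
    have C: "exp (Complex t y * of_real v) * exp (- of_real (2*t) * of_real ?b) = iexp (y * v) * of_real (sech_kernel t v)"
    proof -
      have "exp (v / 2) + exp (- v / 2) = exp (- v / 2) * (1 + exp v)"
        by (simp add: distrib_left mult_exp_exp)
      then have eq: "ln (exp (v / 2) + exp (- v / 2)) = ?b - v / 2"
        using add_pos_pos[OF zero_less_one exp_gt_zero[of v]] by (simp add: ln_mult)
      have "sech_kernel t v = exp (t * v - 2 * t * ?b)"
        using add_pos_pos[OF exp_gt_zero[of "v/2"] exp_gt_zero[of "-v/2"]]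
        unfolding sech_kernel_def powr_def eq by (simp add: algebra_simps)
      then show ?thesis
        unfolding exp_of_real[symmetric] exp_add[symmetric]
        by (simp only: exp_of_real[symmetric] exp_add[symmetric]) (rule arg_cong[where f=exp], simp add: complex_eq_iff)
    qed
    show ?thesis
      using A unfolding B mult.assoc[symmetric] C Gamma_complex_of_real by (simp add: has_bochner_integral_iff)
  qed
  have "(LINT v|lborel. LINT r|lborel. F x r v) = (LINT r|lborel. LINT v|lborel. F x r v)"
    by (rule lborel_pair.Fubini_integral[OF intF])
  also have "\<dots> = (LINT r|lborel. exp (Complex t (-x) * of_real r - of_real (exp r)) * Gamma (Complex t x))"
    using inner_v by (simp add: has_bochner_integral_iff)
  also have "\<dots> = Gamma (Complex t (-x)) * Gamma (Complex t x)"
    using Gamma_integral_exp[of "Complex t (-x)"] t by (simp add: has_bochner_integral_iff)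
  also have "\<dots> = of_real (meixner_weight t x)"
    using Gamma_times_Gamma_cnj[of "Complex t x"] by (simp add: meixner_weight_def mult.commute complex_cnj)
  finally have "(LINT v|lborel. iexp (x * v) * of_real (sech_kernel t v)) * of_real (Gamma (2 * t)) = of_real (meixner_weight t x)"
    by (simp add: inner_r)
  moreover have G: "Gamma (2 * t) > 0" using t by (simp add: Gamma_real_pos)
  ultimately show "(LINT v|lborel. iexp (x * v) * of_real (sech_kernel t v)) = of_real (meixner_weight t x / Gamma (2 * t))"
    by (simp add: field_simps)
  have "integrable lborel (\<lambda>v. LINT r|lborel. F 0 r v)"
    using lborel_pair.integrable_snd[OF intF] .
  then have "integrable lborel (\<lambda>v. complex_of_real (sech_kernel t v * Gamma (2 * t)))"
    by (simp add: inner_r)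
  then have "integrable lborel (\<lambda>v. sech_kernel t v * Gamma (2 * t) / Gamma (2 * t))"
    by (intro integrable_divide) (simp only: complex_of_real_integrable_eq)
  then show "integrable lborel (sech_kernel t)"
    using G by simp
qed

section \<open>The Meixner convolution semigroup\<close>

lemma cmod_Complex_sq: "(cmod (Complex a b))\<^sup>2 = a\<^sup>2 + b\<^sup>2"
  by (simp add: cmod_def)

lemma Complex_nonpos_Ints: "t > 0 \<Longrightarrow> Complex t x \<notin> \<int>\<^sub>\<le>\<^sub>0"
  by (auto elim!: nonpos_Ints_cases simp: complex_eq_iff)

lemma meixner_weight_pos: "t > 0 \<Longrightarrow> meixner_weight t x > 0"
  using Complex_nonpos_Ints[of t x] by (simp add: meixner_weight_def Gamma_eq_zero_iff)

lemma meixner_weight_minus: "meixner_weight t (- x) = meixner_weight t x"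
proof -
  have "Gamma (Complex t (- x)) = cnj (Gamma (Complex t x))"
    by (simp add: cnj_Gamma complex_cnj)
  then show ?thesis by (simp add: meixner_weight_def)
qed

lemma meixner_weight_add_one:
  assumes "t > 0" shows "meixner_weight (t + 1) x = (t\<^sup>2 + x\<^sup>2) * meixner_weight t x"
proof -
  have "Complex (t + 1) x = Complex t x + 1" by (simp add: complex_eq_iff)
  then have "Gamma (Complex (t + 1) x) = Complex t x * Gamma (Complex t x)"
    using Gamma_plus1[OF Complex_nonpos_Ints[OF assms]] by simp
  then show ?thesis
    by (simp add: meixner_weight_def norm_mult power_mult_distrib cmod_Complex_sq)
qed

lemma measurable_meixner_weight [measurable]:
  assumes "t > 0" shows "meixner_weight t \<in> borel_measurable borel"
proof (rule borel_measurable_continuous_onI)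
  have "continuous_on UNIV (\<lambda>x. Gamma (Complex t x))"
    by (rule continuous_on_compose2[of "range (Complex t)" Gamma UNIV "Complex t"])
      (use Complex_nonpos_Ints[OF assms] in \<open>auto intro!: continuous_on_Gamma continuous_intros simp: Complex_eq\<close>)
  then show "continuous_on UNIV (meixner_weight t)"
    unfolding meixner_weight_def by (intro continuous_intros)
qed

text \<open>Up to a positive factor the weight is the transform of a positive kernel, and the
  modulus of such a transform is largest at the origin.\<close>

lemma meixner_weight_le:
  assumes "t > 0" shows "meixner_weight t x \<le> meixner_weight t 0"
proof -
  have G: "Gamma (2 * t) > 0" using assms by (simp add: Gamma_real_pos)
  have "(LINT v|lborel. sech_kernel t v) = meixner_weight t 0 / Gamma (2 * t)"
    using sech_kernel_fourier[OF assms, of 0] by (simp del: of_real_divide)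
  moreover have "cmod (LINT v|lborel. iexp (x * v) * of_real (sech_kernel t v)) \<le> (LINT v|lborel. cmod (iexp (x * v) * of_real (sech_kernel t v)))"
    by (rule integral_norm_bound)
  ultimately have "\<bar>meixner_weight t x / Gamma (2 * t)\<bar> \<le> meixner_weight t 0 / Gamma (2 * t)"
    unfolding sech_kernel_fourier[OF assms] norm_of_real by (simp add: norm_mult sech_kernel_pos less_imp_le)
  then show ?thesis using G by (simp add: field_simps abs_if split: if_splits)
qed

text \<open>The recurrence supplies the decay: the weight of index \<open>t + 1\<close> is bounded,
  and dividing it by \<open>t\<^sup>2 + x\<^sup>2\<close> leaves at most a multiple of a Cauchy
  density. Fourier inversion asks for this integrability.\<close>

lemma integrable_meixner_weight:
  assumes "t > 0" shows "integrable lborel (meixner_weight t)"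
proof -
  have "integrable lborel (\<lambda>x::real. inverse (1 + x\<^sup>2))"
    using integrable_inverse_1_plus_square by (simp add: set_integrable_def)
  then have "integrable lborel (\<lambda>x::real. inverse (1 + (0 + (1 / t) * x)\<^sup>2))"
    by (rule lborel_integrable_real_affine) (use assms in simp)
  then have "integrable lborel (\<lambda>x::real. meixner_weight (t + 1) 0 / t\<^sup>2 * inverse (1 + (x / t)\<^sup>2))"
    by (intro integrable_mult_right) simp
  then show ?thesis
  proof (rule Bochner_Integration.integrable_bound)
    have "meixner_weight t x \<le> meixner_weight (t + 1) 0 / t\<^sup>2 * inverse (1 + (x / t)\<^sup>2)" for x
    proof -
      have pos: "t\<^sup>2 + x\<^sup>2 > 0" using assms by (simp add: add_pos_nonneg)
      have "t\<^sup>2 * (1 + (x / t)\<^sup>2) = t\<^sup>2 + x\<^sup>2" using assms by (simp add: field_simps)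
      then have "meixner_weight (t + 1) 0 / t\<^sup>2 * inverse (1 + (x / t)\<^sup>2) = meixner_weight (t + 1) 0 / (t\<^sup>2 + x\<^sup>2)"
        by (metis divide_divide_eq_left divide_inverse)
      then show ?thesis
        using meixner_weight_add_one[OF assms, of x] meixner_weight_le[of "t + 1" x] assms pos
        by (simp add: pos_le_divide_eq mult.commute)
    qed
    then show "AE x in lborel. norm (meixner_weight t x) \<le> norm (meixner_weight (t + 1) 0 / t\<^sup>2 * inverse (1 + (x / t)\<^sup>2))"
      using meixner_weight_pos[OF assms] by (intro AE_I2) (smt (verit) real_norm_def)
  qed (use assms in measurable)
qed

lemma meixner_weight_inverse_fourier:
  assumes "t > 0"
  shows "(LINT x|lborel. iexp (- (x * v)) * of_real (meixner_weight t x / Gamma (2 * t))) = of_real (2 * pi * sech_kernel t v)"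
proof (rule fourier_inversion[where C=1])
  show "integrable lborel (\<lambda>x. complex_of_real (meixner_weight t x / Gamma (2 * t)))"
    using integrable_meixner_weight[OF assms] by (intro integrable_of_real) simp
  show "\<bar>sech_kernel t x\<bar> \<le> 1" for x
    using sech_kernel_le_1[OF assms] sech_kernel_pos[of t x] by simp
qed (use assms continuous_sech_kernel sech_kernel_integrable sech_kernel_fourier in auto)

text \<open>The total mass is 4^(-t), the value of the kernel at 0. The normalisation is chosen so
  that indices add exactly under convolution; the factor exponential in \<open>t\<close> cancels in
  the bridge.\<close>

definition meixner_density :: "real \<Rightarrow> real \<Rightarrow> real" where
  "meixner_density t x = meixner_weight t x / (2 * pi * Gamma (2 * t))"

lemma meixner_density_pos: "t > 0 \<Longrightarrow> meixner_density t x > 0"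
  by (simp add: meixner_density_def meixner_weight_pos Gamma_real_pos)

lemma meixner_density_minus: "meixner_density t (- x) = meixner_density t x"
  by (simp add: meixner_density_def meixner_weight_minus)

lemma measurable_meixner_density [measurable]: "t > 0 \<Longrightarrow> meixner_density t \<in> borel_measurable borel"
  unfolding meixner_density_def by measurable

lemma meixner_density_le: "t > 0 \<Longrightarrow> meixner_density t x \<le> meixner_density t 0"
  by (simp add: meixner_density_def meixner_weight_le divide_right_mono Gamma_real_pos less_imp_le)

lemma integrable_meixner_density: "t > 0 \<Longrightarrow> integrable lborel (meixner_density t)"
  unfolding meixner_density_def by (intro integrable_divide integrable_meixner_weight)

text \<open>The factor \<open>2 * t * (2 * t + 1)\<close> is the quotient of
  \<open>Gamma (2 * t + 2)\<close> by \<open>Gamma (2 * t)\<close>. Read from left to right, the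
  identity replaces multiplication by \<open>x\<^sup>2\<close> by a shift of the index.\<close>

lemma meixner_density_add_one:
  assumes "t > 0"
  shows "(t\<^sup>2 + x\<^sup>2) * meixner_density t x = 2 * t * (2 * t + 1) * meixner_density (t + 1) x"
proof -
  have Z: "2 * t + 1 \<notin> \<int>\<^sub>\<le>\<^sub>0" "2 * t \<notin> \<int>\<^sub>\<le>\<^sub>0"
    using assms by (auto elim!: nonpos_Ints_cases)
  have "Gamma (2 * (t + 1)) = (2 * t + 1) * Gamma (2 * t + 1)"
    using Gamma_plus1[OF Z(1)] by (simp add: algebra_simps)
  also have "Gamma (2 * t + 1) = 2 * t * Gamma (2 * t)"
    by (rule Gamma_plus1[OF Z(2)])
  finally have G: "Gamma (2 * (t + 1)) = (2 * t + 1) * (2 * t * Gamma (2 * t))" .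
  have "Gamma (2 * t) > 0" using assms by (simp add: Gamma_real_pos)
  then show ?thesis
    using assms unfolding meixner_density_def meixner_weight_add_one[OF assms] G
    by (simp add: divide_simps)
qed

text \<open>The kernels multiply, so their transforms convolve. Only the second factor is expanded
  as a Fourier integral; Fubini then leaves an inverse transform of the first factor, which is where
  inversion enters.\<close>

lemma meixner_density_convolution:
  assumes s: "s > 0" and t: "t > 0"
  shows "has_bochner_integral lborel (\<lambda>y. meixner_density s y * meixner_density t (x - y)) (meixner_density (s + t) x)"
proof -
  let ?h = "\<lambda>t x. meixner_weight t x / Gamma (2 * t)"
  have st: "s + t > 0" using s t by simp
  have G: "Gamma (2 * s) > 0" "Gamma (2 * t) > 0" using s t by (simp_all add: Gamma_real_pos)
  have [measurable]: "meixner_weight s \<in> borel_measurable borel" "meixner_weight t \<in> borel_measurable borel"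
    using s t by measurable
  have inth: "integrable lborel (?h s)" using integrable_meixner_weight[OF s] by simp
  define F where "F y v = iexp ((x - y) * v) * of_real (?h s y * sech_kernel t v)" for y v
  have intF: "integrable (lborel \<Otimes>\<^sub>M lborel) (case_prod F)"
  proof (rule lborel_pair.Fubini_integrable)
    show "case_prod F \<in> borel_measurable (lborel \<Otimes>\<^sub>M lborel)"
      unfolding F_def case_prod_beta by measurable
    have "integrable lborel (\<lambda>y. \<bar>?h s y\<bar> * (LINT v|lborel. \<bar>sech_kernel t v\<bar>))"
      using inth by (intro integrable_mult_left integrable_abs)
    then show "integrable lborel (\<lambda>y. LINT v|lborel. norm (case (y, v) of (y, v) \<Rightarrow> F y v))"
      by (simp add: F_def norm_mult abs_mult norm_divide)
    show "AE y in lborel. integrable lborel (\<lambda>v. case (y, v) of (y, v) \<Rightarrow> F y v)"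
    proof (rule AE_I2)
      fix y :: real
      have "integrable lborel (\<lambda>v. F y v)"
        by (rule Bochner_Integration.integrable_bound[of _ "\<lambda>v. ?h s y * sech_kernel t v"])
          (auto simp: F_def norm_mult norm_divide abs_mult sech_kernel_integrable[OF t])
      then show "integrable lborel (\<lambda>v. case (y, v) of (y, v) \<Rightarrow> F y v)" by simp
    qed
  qed
  have "complex_of_real (LINT y|lborel. ?h s y * ?h t (x - y)) = (LINT y|lborel. of_real (?h s y) * of_real (?h t (x - y)))"
    by (simp only: integral_complex_of_real[symmetric] of_real_mult)
  also have "\<dots> = (LINT y|lborel. LINT v|lborel. F y v)"
    unfolding F_def sech_kernel_fourier[OF t, symmetric] of_real_mult
    by (intro Bochner_Integration.integral_cong refl)
      (simp add: integral_mult_right_zero[symmetric] mult_ac del: integral_mult_right_zero of_real_divide)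
  also have "\<dots> = (LINT v|lborel. LINT y|lborel. F y v)"
    by (rule lborel_pair.Fubini_integral[OF intF, symmetric])
  also have "\<dots> = (LINT v|lborel. iexp (x * v) * of_real (sech_kernel t v) * of_real (2 * pi * sech_kernel s v))"
    unfolding meixner_weight_inverse_fourier[OF s, symmetric]
  proof (intro Bochner_Integration.integral_cong refl)
    fix v :: real
    have "F y v = iexp (x * v) * of_real (sech_kernel t v) * (iexp (- (y * v)) * of_real (?h s y))" for y
    proof -
      have "iexp ((x - y) * v) = iexp (x * v) * iexp (- (y * v))"
        unfolding exp_add[symmetric] by (simp add: algebra_simps)
      then show ?thesis unfolding F_def of_real_mult by (simp only: mult_ac)
    qed
    then show "(LINT y|lborel. F y v) = iexp (x * v) * of_real (sech_kernel t v) * (LINT y|lborel. iexp (- (y * v)) * of_real (?h s y))"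
      by (simp only: integral_mult_right_zero)
  qed
  also have "\<dots> = 2 * pi * (LINT v|lborel. iexp (x * v) * of_real (sech_kernel (s + t) v))"
    by (simp add: integral_mult_right_zero[symmetric] sech_kernel_add mult_ac del: integral_mult_right_zero)
  also have "\<dots> = of_real (2 * pi * ?h (s + t) x)"
    unfolding sech_kernel_fourier[OF st] by simp
  finally have *: "(LINT y|lborel. ?h s y * ?h t (x - y)) = 2 * pi * ?h (s + t) x"
    by (simp only: of_real_eq_iff)
  have "(LINT y|lborel. meixner_density s y * meixner_density t (x - y)) = (LINT y|lborel. ?h s y * ?h t (x - y) / (2 * pi)\<^sup>2)"
    by (intro Bochner_Integration.integral_cong refl) (simp add: meixner_density_def power2_eq_square)
  also have "\<dots> = meixner_density (s + t) x"
    unfolding integral_divide_zero * by (simp add: meixner_density_def power2_eq_square)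
  finally have "(LINT y|lborel. meixner_density s y * meixner_density t (x - y)) = meixner_density (s + t) x" .
  moreover have "integrable lborel (\<lambda>y. meixner_density s y * meixner_density t (x - y))"
  proof (rule Bochner_Integration.integrable_bound)
    show "integrable lborel (\<lambda>y. meixner_density s y * meixner_density t 0)"
      using integrable_meixner_density[OF s] by (rule integrable_mult_left)
    show "AE y in lborel. norm (meixner_density s y * meixner_density t (x - y)) \<le> norm (meixner_density s y * meixner_density t 0)"
      using meixner_density_pos[OF s] meixner_density_pos[OF t] meixner_density_le[OF t]
      by (intro AE_I2) (simp add: abs_mult less_imp_le)
  qed (use s t in measurable)
  ultimately show ?thesis by (simp add: has_bochner_integral_iff)
qed

text \<open>By the recurrence, \<open>y\<^sup>2\<close> times the density of index \<open>s\<close>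
  is a combination of the densities of index \<open>s + 1\<close> and \<open>s\<close>. Both are
  convolved explicitly, and the recurrence at \<open>s + t\<close> brings the index back
  down.\<close>

lemma meixner_density_convolution_square:
  assumes s: "s > 0" and t: "t > 0"
  shows "has_bochner_integral lborel (\<lambda>y. y\<^sup>2 * (meixner_density s y * meixner_density t (x - y)))
    ((s * (2 * s + 1) * ((s + t)\<^sup>2 + x\<^sup>2) / ((s + t) * (2 * (s + t) + 1)) - s\<^sup>2) * meixner_density (s + t) x)"
proof -
  have "has_bochner_integral lborel (\<lambda>y. 2 * s * (2 * s + 1) * (meixner_density (s + 1) y * meixner_density t (x - y))
      - s\<^sup>2 * (meixner_density s y * meixner_density t (x - y)))
      (2 * s * (2 * s + 1) * meixner_density (s + 1 + t) x - s\<^sup>2 * meixner_density (s + t) x)"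
    by (intro has_bochner_integral_diff has_bochner_integral_mult_right meixner_density_convolution) (use s t in auto)
  moreover have "2 * s * (2 * s + 1) * (meixner_density (s + 1) y * meixner_density t (x - y))
      - s\<^sup>2 * (meixner_density s y * meixner_density t (x - y)) = y\<^sup>2 * (meixner_density s y * meixner_density t (x - y))" for y
    using arg_cong[OF meixner_density_add_one[OF s, of y], of "\<lambda>u. u * meixner_density t (x - y)"]
    by (simp add: algebra_simps)
  moreover have "2 * s * (2 * s + 1) * meixner_density (s + 1 + t) x - s\<^sup>2 * meixner_density (s + t) x =
      (s * (2 * s + 1) * ((s + t)\<^sup>2 + x\<^sup>2) / ((s + t) * (2 * (s + t) + 1)) - s\<^sup>2) * meixner_density (s + t) x"
  proof -
    have eq: "meixner_density (s + 1 + t) x = ((s + t)\<^sup>2 + x\<^sup>2) * meixner_density (s + t) x / (2 * (s + t) * (2 * (s + t) + 1))"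
    proof (rule nonzero_eq_divide_eq[THEN iffD2])
      show "meixner_density (s + 1 + t) x * (2 * (s + t) * (2 * (s + t) + 1)) = ((s + t)\<^sup>2 + x\<^sup>2) * meixner_density (s + t) x"
        using meixner_density_add_one[of "s + t" x] s t by (simp add: ac_simps)
    qed (use s t in auto)
    have gen: "2 * s * (2 * s + 1) * (y * d / (2 * u * (2 * u + 1))) - z * d =
        (s * (2 * s + 1) * y / (u * (2 * u + 1)) - z) * d" if "u > 0" for u y d z
      using that by (simp add: divide_simps) (simp add: algebra_simps)
    show ?thesis unfolding eq by (rule gen) (use s t in simp)
  qed
  ultimately show ?thesis by (simp only:)
qed

lemma meixner_density_convolution_mean:
  assumes s: "s > 0" and t: "t > 0"
  shows "has_bochner_integral lborel (\<lambda>y. y * (meixner_density s y * meixner_density t (x - y)))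
    (s * x / (s + t) * meixner_density (s + t) x)"
proof -
  let ?p = "\<lambda>y. meixner_density s y * meixner_density t (x - y)"
  have int: "integrable lborel (\<lambda>y. y * ?p y)"
  proof (rule Bochner_Integration.integrable_bound)
    show "integrable lborel (\<lambda>y. ?p y + y\<^sup>2 * ?p y)"
      using meixner_density_convolution[OF s t] meixner_density_convolution_square[OF s t]
      by (intro Bochner_Integration.integrable_add) (simp_all add: has_bochner_integral_iff)
    have "\<bar>y\<bar> \<le> 1 + y\<^sup>2" for y :: real
    proof -
      have "0 \<le> (\<bar>y\<bar> - 1)\<^sup>2" by simp
      then have "2 * \<bar>y\<bar> \<le> 1 + y\<^sup>2" by (simp add: power2_diff)
      moreover have "0 \<le> y\<^sup>2" by simp
      ultimately show ?thesis by linarith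
    qed
    then have "\<bar>y\<bar> * ?p y \<le> (1 + y\<^sup>2) * ?p y" for y
      using meixner_density_pos[OF s] meixner_density_pos[OF t] by (intro mult_right_mono) (simp_all add: less_imp_le)
    then show "AE y in lborel. norm (y * ?p y) \<le> norm (?p y + y\<^sup>2 * ?p y)"
      using meixner_density_pos[OF s] meixner_density_pos[OF t]
      by (intro AE_I2) (simp add: abs_mult distrib_right abs_of_pos add_nonneg_nonneg less_imp_le)
  qed (use s t in measurable)
  \<comment> \<open>Subtracting the second moments of \<open>y\<close> and \<open>x - y\<close> gives the mean multiplied by \<open>2x\<close>; for \<open>x = 0\<close> it vanishes by symmetry.\<close>
  show ?thesis
  proof (cases "x = 0")
    case True
    have "(LINT y|lborel. y * ?p y) = \<bar>-1\<bar> *\<^sub>R (LINT y|lborel. (0 + (-1) * y) * ?p (0 + (-1) * y))"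
      by (rule lborel_integral_real_affine) simp
    also have "\<dots> = - (LINT y|lborel. y * ?p y)"
      using True meixner_density_minus[of t] meixner_density_minus[of s] by simp
    finally have "(LINT y|lborel. y * ?p y) = 0" by simp
    then show ?thesis using int True by (simp add: has_bochner_integral_iff)
  next
    case False
    \<comment> \<open>The reflection of \<open>y\<close> to \<open>x - y\<close> exchanges the two
      densities, so this is the second moment with \<open>s\<close> and \<open>t\<close>
      interchanged.\<close>
    have "has_bochner_integral lborel (\<lambda>y. (0 + 1 * (x - y))\<^sup>2 * (meixner_density t (x - y) * meixner_density s (x - (x - y))))
      ((t * (2 * t + 1) * ((t + s)\<^sup>2 + x\<^sup>2) / ((t + s) * (2 * (t + s) + 1)) - t\<^sup>2) * meixner_density (t + s) x)"
      using meixner_density_convolution_square[OF t s, of x]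
      by (subst (asm) lborel_has_bochner_integral_real_affine_iff[of "-1" _ _ x]) auto
    then have "has_bochner_integral lborel (\<lambda>y. inverse (2 * x) * (y\<^sup>2 * ?p y + x\<^sup>2 * ?p y - (x - y)\<^sup>2 * ?p y))
      (inverse (2 * x) * ((s * (2 * s + 1) * ((s + t)\<^sup>2 + x\<^sup>2) / ((s + t) * (2 * (s + t) + 1)) - s\<^sup>2) * meixner_density (s + t) x
         + x\<^sup>2 * meixner_density (s + t) x
         - (t * (2 * t + 1) * ((s + t)\<^sup>2 + x\<^sup>2) / ((s + t) * (2 * (s + t) + 1)) - t\<^sup>2) * meixner_density (s + t) x))"
      by (intro has_bochner_integral_mult_right has_bochner_integral_diff has_bochner_integral_add
          meixner_density_convolution meixner_density_convolution_square s t) (simp add: mult_ac add.commute)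
    moreover have "inverse (2 * x) * (y\<^sup>2 * ?p y + x\<^sup>2 * ?p y - (x - y)\<^sup>2 * ?p y) = y * ?p y" for y
    proof -
      have "y\<^sup>2 * ?p y + x\<^sup>2 * ?p y - (x - y)\<^sup>2 * ?p y = 2 * x * (y * ?p y)"
        by (simp add: power2_eq_square algebra_simps)
      then show ?thesis using False by simp
    qed
    moreover have "inverse (2 * x) * ((s * (2 * s + 1) * ((s + t)\<^sup>2 + x\<^sup>2) / ((s + t) * (2 * (s + t) + 1)) - s\<^sup>2) * d
         + x\<^sup>2 * d
         - (t * (2 * t + 1) * ((s + t)\<^sup>2 + x\<^sup>2) / ((s + t) * (2 * (s + t) + 1)) - t\<^sup>2) * d) = s * x / (s + t) * d" for d
    proof -
      have "s * (2 * s + 1) * ((s + t)\<^sup>2 + x\<^sup>2) / ((s + t) * (2 * (s + t) + 1)) - s\<^sup>2 + x\<^sup>2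
         - (t * (2 * t + 1) * ((s + t)\<^sup>2 + x\<^sup>2) / ((s + t) * (2 * (s + t) + 1)) - t\<^sup>2) =
         (s * (2 * s + 1) - t * (2 * t + 1)) / ((s + t) * (2 * (s + t) + 1)) * ((s + t)\<^sup>2 + x\<^sup>2) - (s\<^sup>2 - t\<^sup>2) + x\<^sup>2"
        by (simp add: diff_divide_distrib algebra_simps)
      also have "(s * (2 * s + 1) - t * (2 * t + 1)) / ((s + t) * (2 * (s + t) + 1)) = (s - t) / (s + t)"
        using s t by (simp add: divide_simps) (simp add: algebra_simps)
      also have "(s - t) / (s + t) * ((s + t)\<^sup>2 + x\<^sup>2) - (s\<^sup>2 - t\<^sup>2) + x\<^sup>2 = 2 * x * (s * x / (s + t))"
        using s t by (simp add: divide_simps) (simp add: algebra_simps power2_eq_square)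
      finally have *: "s * (2 * s + 1) * ((s + t)\<^sup>2 + x\<^sup>2) / ((s + t) * (2 * (s + t) + 1)) - s\<^sup>2 + x\<^sup>2
         - (t * (2 * t + 1) * ((s + t)\<^sup>2 + x\<^sup>2) / ((s + t) * (2 * (s + t) + 1)) - t\<^sup>2) = 2 * x * (s * x / (s + t))" .
      have "inverse (2 * x) * ((a - s\<^sup>2) * d + x\<^sup>2 * d - (b - t\<^sup>2) * d) = m * d"
        if "a - s\<^sup>2 + x\<^sup>2 - (b - t\<^sup>2) = 2 * x * m" for a b m
      proof -
        have "(a - s\<^sup>2) * d + x\<^sup>2 * d - (b - t\<^sup>2) * d = 2 * x * m * d"
          unfolding that[symmetric] by (simp add: algebra_simps)
        then show ?thesis using False by simp
      qed
      from this[OF *] show ?thesis .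
    qed
    ultimately show ?thesis by (simp only:)
  qed
qed

text \<open>The point is the factorised form: the way in which \<open>s + t\<close> is split enters
  only through the product \<open>s * t\<close>, and \<open>x\<close> enters only through
  \<open>(s + t)\<^sup>2 + x\<^sup>2\<close>. This becomes the quadratic conditional
  variance.\<close>

lemma meixner_density_convolution_variance:
  assumes s: "s > 0" and t: "t > 0"
  shows "has_bochner_integral lborel (\<lambda>y. (y - s * x / (s + t))\<^sup>2 * (meixner_density s y * meixner_density t (x - y)))
    (s * t * ((s + t)\<^sup>2 + x\<^sup>2) / ((s + t)\<^sup>2 * (2 * (s + t) + 1)) * meixner_density (s + t) x)"
proof -
  let ?p = "\<lambda>y. meixner_density s y * meixner_density t (x - y)" and ?m = "s * x / (s + t)"
  have "has_bochner_integral lborel (\<lambda>y. y\<^sup>2 * ?p y - 2 * ?m * (y * ?p y) + ?m\<^sup>2 * ?p y)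
    ((s * (2 * s + 1) * ((s + t)\<^sup>2 + x\<^sup>2) / ((s + t) * (2 * (s + t) + 1)) - s\<^sup>2) * meixner_density (s + t) x
     - 2 * ?m * (?m * meixner_density (s + t) x) + ?m\<^sup>2 * meixner_density (s + t) x)"
    by (intro has_bochner_integral_mult_right has_bochner_integral_diff has_bochner_integral_add
          meixner_density_convolution meixner_density_convolution_square meixner_density_convolution_mean s t)
  moreover have "y\<^sup>2 * ?p y - 2 * ?m * (y * ?p y) + ?m\<^sup>2 * ?p y = (y - ?m)\<^sup>2 * ?p y" for y
    by (simp add: power2_diff algebra_simps)
  moreover have "(s * (2 * s + 1) * ((s + t)\<^sup>2 + x\<^sup>2) / ((s + t) * (2 * (s + t) + 1)) - s\<^sup>2) * d
     - 2 * ?m * (?m * d) + ?m\<^sup>2 * d = s * t * ((s + t)\<^sup>2 + x\<^sup>2) / ((s + t)\<^sup>2 * (2 * (s + t) + 1)) * d" for d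
  proof -
    define u where "u = s + t"
    have u: "u > 0" "t = u - s" using s t by (simp_all add: u_def)
    have "s * (2 * s + 1) * (u\<^sup>2 + x\<^sup>2) / (u * (2 * u + 1)) - s\<^sup>2 - (s * x / u)\<^sup>2 =
       s * (u - s) * (u\<^sup>2 + x\<^sup>2) / (u\<^sup>2 * (2 * u + 1))"
      using u(1) by (simp add: divide_simps) (simp add: algebra_simps power2_eq_square)
    then show ?thesis unfolding u_def[symmetric] u(2)
      by (simp add: algebra_simps power2_eq_square)
  qed
  ultimately show ?thesis by (simp only:)
qed

section \<open>Bridges of convolution semigroups\<close>

lemma strict_sorted_adjacent_split:
  fixes xs :: "'a::linorder list"
  assumes "sorted_wrt (<) xs" "a \<in> set xs" "b \<in> set xs" "a < b"
    and "\<And>c. c \<in> set xs \<Longrightarrow> c \<le> a \<or> b \<le> c"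
  obtains us vs where "xs = us @ [a, b] @ vs"
proof -
  obtain us zs where xs: "xs = us @ a # zs"
    using split_list[OF assms(2)] by blast
  have b: "b \<in> set zs"
    using assms(1,3,4) unfolding xs by (auto simp: sorted_wrt_append)
  then obtain c vs where zs: "zs = c # vs" by (cases zs) auto
  have "c = b"
    using assms(1) assms(5)[of c] b unfolding xs zs by (auto simp: sorted_wrt_append)
  then show thesis using that xs zs by simp
qed

text \<open>A new time between two neighbours splits just their link, so a product over consecutive
  times changes in one place only.\<close>

lemma sorted_list_of_set_insert_between:
  fixes A :: "'a::linorder set"
  assumes fin: "finite A" and ab: "a \<in> A" "b \<in> A" "a < t" "t < b"
    and gap: "\<And>c. c \<in> A \<Longrightarrow> c \<le> a \<or> b \<le> c"
  obtains us vs where "sorted_list_of_set A = us @ [a, b] @ vs"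
    "sorted_list_of_set (insert t A) = us @ [a, t, b] @ vs"
proof -
  obtain us vs where *: "sorted_list_of_set A = us @ [a, b] @ vs"
    by (rule strict_sorted_adjacent_split[of "sorted_list_of_set A" a b]) (use assms in auto)
  have s: "sorted_wrt (<) (us @ [a, b] @ vs)"
    unfolding *[symmetric] by (rule strict_sorted_list_of_set)
  have "sorted_list_of_set (insert t A) = us @ [a, t, b] @ vs"
  proof (rule strict_sorted_equal)
    show "sorted_wrt (<) (us @ [a, t, b] @ vs)"
      using s ab(3,4) by (auto simp: sorted_wrt_append)
    have "set (us @ [a, b] @ vs) = A" unfolding *[symmetric] using fin by simp
    moreover have "set (sorted_list_of_set (insert t A)) = insert t A"
      using fin by (intro set_sorted_list_of_set) simp
    ultimately show "set (sorted_list_of_set (insert t A)) = set (us @ [a, t, b] @ vs)"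
      by auto
  qed (rule strict_sorted_list_of_set)
  with * show thesis by (rule that)
qed

section \<open>Finite-dimensional distributions of the pinned process\<close>

locale convolution_bridge =
  fixes q :: "real \<Rightarrow> real \<Rightarrow> real" and T z :: real
  assumes T_pos: "T > 0"
    and q_measurable: "\<And>t. t > 0 \<Longrightarrow> q t \<in> borel_measurable borel"
    and q_pos: "\<And>t x. t > 0 \<Longrightarrow> q t x > 0"
    and q_convolution: "\<And>s t x. s > 0 \<Longrightarrow> t > 0 \<Longrightarrow>
      (\<integral>\<^sup>+y. ennreal (q s y * q t (x - y)) \<partial>lborel) = ennreal (q (s + t) x)"
begin

text \<open>The prescribed end values are not coordinates of the product space. Reading paths
  through \<open>pin\<close> lets \<open>0\<close> and \<open>T\<close> occur in a grid like any
  other time.\<close>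

definition pin :: "(real \<Rightarrow> real) \<Rightarrow> real \<Rightarrow> real" where
  "pin p r = (if r \<le> 0 then 0 else if T \<le> r then z else p r)"

fun path_density :: "(real \<Rightarrow> real) \<Rightarrow> real list \<Rightarrow> ennreal" where
  "path_density p (s # t # ts) = ennreal (q (t - s) (pin p t - pin p s)) * path_density p (t # ts)"
| "path_density p _ = 1"

definition grid :: "real set \<Rightarrow> real list" where
  "grid J = sorted_list_of_set (insert 0 (insert T J))"

text \<open>The denominator is the path density of the grid that consists of \<open>0\<close> and
  \<open>T\<close> alone; dividing by it conditions on the end point and absorbs the total mass of
  the kernels.\<close>

definition fdd :: "real set \<Rightarrow> (real \<Rightarrow> real) measure" where
  "fdd J = density (PiM J (\<lambda>_. lborel)) (\<lambda>p. path_density p (grid J) / ennreal (q T z))"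

lemma pin_upd: "r \<noteq> t \<Longrightarrow> pin (p(t := y)) r = pin p r"
  by (simp add: pin_def)

lemma path_density_upd: "t \<notin> set ts \<Longrightarrow> path_density (p(t := y)) ts = path_density p ts"
proof (induction ts)
  case (Cons s ts)
  then show ?case by (cases ts) (auto simp: pin_upd simp del: fun_upd_apply)
qed simp

text \<open>The Markov property at the level of densities. The time \<open>a\<close> at which the
  path is cut belongs to both pieces, so no link is lost.\<close>

lemma path_density_append:
  "path_density p (us @ a # vs) = path_density p (us @ [a]) * path_density p (a # vs)"
proof (induction us)
  case Nil
  then show ?case by (cases vs) auto
next
  case (Cons u us)
  then show ?case by (cases us) (auto simp: mult.assoc)
qed

lemma pin_measurable:
  assumes "0 < r \<Longrightarrow> r < T \<Longrightarrow> r \<in> J" "\<And>j. j \<in> J \<Longrightarrow> sets (N j) = sets borel"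
  shows "(\<lambda>p. pin p r) \<in> borel_measurable (PiM J N)"
proof (cases "0 < r \<and> r < T")
  case True
  then have "(\<lambda>p. p r) \<in> measurable (PiM J N) (N r)" using assms by (intro measurable_component_singleton) auto
  moreover have "measurable (PiM J N) (N r) = borel_measurable (PiM J N)"
    using True assms by (intro measurable_cong_sets) auto
  ultimately show ?thesis using True by (simp add: pin_def)
next
  case False
  then have "(\<lambda>p. pin p r) = (\<lambda>_. if r \<le> 0 then 0 else z)" by (auto simp: pin_def)
  then show ?thesis by simp
qed

lemma path_density_measurable:
  assumes "sorted_wrt (<) ts" "\<And>r. r \<in> set ts \<Longrightarrow> 0 < r \<Longrightarrow> r < T \<Longrightarrow> r \<in> J"
  shows "(\<lambda>p. path_density p ts) \<in> borel_measurable (PiM J (\<lambda>_. lborel))"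
  using assms
proof (induction ts)
  case (Cons s ts)
  show ?case
  proof (cases ts)
    case (Cons t us)
    have [measurable]: "q (t - s) \<in> borel_measurable borel"
      using Cons.prems(1) Cons by (intro q_measurable) auto
    have [measurable]: "(\<lambda>p. pin p s) \<in> borel_measurable (PiM J (\<lambda>_. lborel))"
      "(\<lambda>p. pin p t) \<in> borel_measurable (PiM J (\<lambda>_. lborel))"
      using Cons.prems(2) Cons by (auto intro!: pin_measurable)
    have [measurable]: "(\<lambda>p. path_density p (t # us)) \<in> borel_measurable (PiM J (\<lambda>_. lborel))"
      using Cons.IH Cons.prems Cons by auto
    show ?thesis unfolding Cons path_density.simps by measurable
  qed simp
qed simp

lemma set_grid: "finite J \<Longrightarrow> set (grid J) = insert 0 (insert T J)"
  unfolding grid_def by (intro set_sorted_list_of_set) simp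

lemma sorted_grid: "sorted_wrt (<) (grid J)"
  unfolding grid_def by (rule strict_sorted_list_of_set)

lemma grid_measurable:
  assumes "finite J"
  shows "(\<lambda>p. path_density p (grid J)) \<in> borel_measurable (PiM J (\<lambda>_. lborel))"
  using assms by (intro path_density_measurable sorted_grid) (auto simp: set_grid)

lemma sets_fdd: "sets (fdd J) = sets (PiM J (\<lambda>_. borel))"
  unfolding fdd_def sets_density by (intro sets_PiM_cong) auto

text \<open>Only the two links at \<open>t\<close> involve \<open>y\<close>, so an identity for two
  kernels passes to the whole path density. The functions \<open>g\<close> and \<open>m\<close> stay
  general: the constant 1 yields consistency of the marginals, squared deviations yield conditional
  moments.\<close>

lemma nn_integral_path_density_insert:
  assumes J: "finite J" and ab: "a \<in> insert 0 (insert T J)" "b \<in> insert 0 (insert T J)" "a < t" "t < b"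
    and gap: "\<And>c. c \<in> insert 0 (insert T J) \<Longrightarrow> c \<le> a \<or> b \<le> c"
    and g: "g \<in> borel_measurable borel"
    and m: "(\<integral>\<^sup>+y. g y * ennreal (q (t - a) (y - pin p a) * q (b - t) (pin p b - y)) \<partial>lborel) =
      m * ennreal (q (b - a) (pin p b - pin p a))"
    and t: "0 < t" "t < T"
  shows "(\<integral>\<^sup>+y. g y * path_density (p(t := y)) (grid (insert t J)) \<partial>lborel) = m * path_density p (grid J)"
proof -
  obtain us vs where us: "grid J = us @ [a, b] @ vs"
    and us': "sorted_list_of_set (insert t (insert 0 (insert T J))) = us @ [a, t, b] @ vs"
    using sorted_list_of_set_insert_between[of "insert 0 (insert T J)" a b t] J ab gap
    unfolding grid_def by auto
  have ins: "grid (insert t J) = us @ [a, t, b] @ vs"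
    using us' by (simp add: grid_def insert_commute)
  have "sorted_wrt (<) (us @ [a, t, b] @ vs)"
    unfolding us'[symmetric] by (rule strict_sorted_list_of_set)
  then have notin: "t \<notin> set (us @ [a])" "t \<notin> set (b # vs)" "t \<noteq> a" "t \<noteq> b"
    by (auto simp: sorted_wrt_append)
  have [measurable]: "q (t - a) \<in> borel_measurable borel" "q (b - t) \<in> borel_measurable borel"
    using ab by (auto intro: q_measurable)
  have split: "path_density (p(t := y)) (grid (insert t J)) = path_density p (us @ [a]) *
     (ennreal (q (t - a) (y - pin p a) * q (b - t) (pin p b - y)) * path_density p (b # vs))" for y
  proof -
    have "path_density (p(t := y)) (grid (insert t J)) =
        path_density (p(t := y)) (us @ [a]) * path_density (p(t := y)) (a # t # b # vs)"
      unfolding ins using path_density_append[of _ us a "t # b # vs"] by simp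
    also have "path_density (p(t := y)) (us @ [a]) = path_density p (us @ [a])"
      using notin by (intro path_density_upd)
    also have "path_density (p(t := y)) (a # t # b # vs) =
       ennreal (q (t - a) (y - pin p a)) * (ennreal (q (b - t) (pin p b - y)) * path_density (p(t := y)) (b # vs))"
      using notin t by (simp add: pin_upd) (simp add: pin_def)
    also have "path_density (p(t := y)) (b # vs) = path_density p (b # vs)"
      using notin by (intro path_density_upd)
    finally show ?thesis
      using ab q_pos by (simp add: ennreal_mult less_imp_le mult.assoc del: fun_upd_apply)
  qed
  have "(\<integral>\<^sup>+y. g y * path_density (p(t := y)) (grid (insert t J)) \<partial>lborel) =
     (\<integral>\<^sup>+y. path_density p (us @ [a]) * path_density p (b # vs) *
        (g y * ennreal (q (t - a) (y - pin p a) * q (b - t) (pin p b - y))) \<partial>lborel)"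
    unfolding split by (simp only: mult_ac)
  also have "\<dots> = path_density p (us @ [a]) * path_density p (b # vs) *
      (\<integral>\<^sup>+y. g y * ennreal (q (t - a) (y - pin p a) * q (b - t) (pin p b - y)) \<partial>lborel)"
  proof (rule nn_integral_cmult)
    have "(\<lambda>y. ennreal (q (t - a) (y - c) * q (b - t) (d - y))) \<in> borel_measurable borel" for c d
      by measurable
    then show "(\<lambda>y. g y * ennreal (q (t - a) (y - pin p a) * q (b - t) (pin p b - y))) \<in> borel_measurable lborel"
      using g by (intro borel_measurable_times_ennreal) simp_all
  qed
  also have "\<dots> = m * (path_density p (us @ [a]) * path_density p (a # b # vs))"
    unfolding m by (simp add: mult_ac)
  also have "path_density p (us @ [a]) * path_density p (a # b # vs) = path_density p (grid J)"
    unfolding us using path_density_append[of p us a "b # vs"] by simp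
  finally show ?thesis .
qed

text \<open>Here \<open>h\<close> is an arbitrary nonnegative test function of the old coordinates,
  so in effect \<open>m\<close> is the conditional expectation of \<open>g\<close> given all times
  in \<open>J\<close>. It depends on the two neighbours of \<open>t\<close> only.\<close>

lemma nn_integral_fdd_insert:
  assumes J: "finite J" and ab: "a \<in> insert 0 (insert T J)" "b \<in> insert 0 (insert T J)" "a < t" "t < b"
    and gap: "\<And>c. c \<in> insert 0 (insert T J) \<Longrightarrow> c \<le> a \<or> b \<le> c"
    and g: "(\<lambda>(x, w, y). g x w y) \<in> borel_measurable (borel \<Otimes>\<^sub>M borel \<Otimes>\<^sub>M borel)"
    and m: "(\<lambda>(x, w). m x w) \<in> borel_measurable (borel \<Otimes>\<^sub>M borel)"
    and gm: "\<And>x w. (\<integral>\<^sup>+y. g x w y * ennreal (q (t - a) (y - x) * q (b - t) (w - y)) \<partial>lborel) =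
      m x w * ennreal (q (b - a) (w - x))"
    and t: "0 < t" "t < T"
    and h: "h \<in> borel_measurable (PiM J (\<lambda>_. borel))"
  shows "(\<integral>\<^sup>+p. h (restrict p J) * g (pin p a) (pin p b) (p t) \<partial>fdd (insert t J)) =
    (\<integral>\<^sup>+p. h p * m (pin p a) (pin p b) \<partial>fdd J)"
proof -
  interpret product_sigma_finite "\<lambda>_::real. lborel :: real measure" ..
  have tJ: "t \<notin> J" using gap[of t] ab by auto
  have h'[measurable]: "h \<in> borel_measurable (PiM J (\<lambda>_. lborel))"
    using h by (subst measurable_cong_sets[OF sets_PiM_cong refl]) auto
  have [measurable]: "(\<lambda>p. restrict p J) \<in> measurable (PiM (insert t J) (\<lambda>_. lborel)) (PiM J (\<lambda>_. lborel :: real measure))"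
    by (intro measurable_restrict_subset) auto
  have pin1 [measurable]: "(\<lambda>p. pin p a) \<in> borel_measurable (PiM (insert t J) (\<lambda>_. lborel))"
     "(\<lambda>p. pin p b) \<in> borel_measurable (PiM (insert t J) (\<lambda>_. lborel))"
     "(\<lambda>p. pin p a) \<in> borel_measurable (PiM J (\<lambda>_. lborel))"
     "(\<lambda>p. pin p b) \<in> borel_measurable (PiM J (\<lambda>_. lborel))"
    using ab by (auto intro!: pin_measurable)
  have [measurable]: "(\<lambda>p. p t) \<in> borel_measurable (PiM (insert t J) (\<lambda>_. lborel))"
    by measurable
  have [measurable]: "(\<lambda>p. g (pin p a) (pin p b) (p t)) \<in> borel_measurable (PiM (insert t J) (\<lambda>_. lborel))"
    using measurable_compose[OF _ g, of "\<lambda>p. (pin p a, pin p b, p t)" "PiM (insert t J) (\<lambda>_. lborel)"] by simp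
  have [measurable]: "(\<lambda>p. m (pin p a) (pin p b)) \<in> borel_measurable (PiM J (\<lambda>_. lborel))"
    using measurable_compose[OF _ m, of "\<lambda>p. (pin p a, pin p b)" "PiM J (\<lambda>_. lborel)"] by simp
  have g1: "g x w \<in> borel_measurable borel" for x w
    using measurable_compose[OF _ g, of "\<lambda>y. (x, w, y)" borel] by simp
  have [measurable]: "(\<lambda>p. path_density p (grid (insert t J))) \<in> borel_measurable (PiM (insert t J) (\<lambda>_. lborel))"
    "(\<lambda>p. path_density p (grid J)) \<in> borel_measurable (PiM J (\<lambda>_. lborel))"
    using J by (auto intro!: grid_measurable)
  let ?c = "ennreal (q T z)"
  have "(\<integral>\<^sup>+p. h (restrict p J) * g (pin p a) (pin p b) (p t) \<partial>fdd (insert t J)) =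
     (\<integral>\<^sup>+p. path_density p (grid (insert t J)) / ?c * (h (restrict p J) * g (pin p a) (pin p b) (p t)) \<partial>PiM (insert t J) (\<lambda>_. lborel))"
    unfolding fdd_def by (subst nn_integral_density) measurable
  also have "\<dots> = (\<integral>\<^sup>+p. (\<integral>\<^sup>+y. path_density (p(t := y)) (grid (insert t J)) / ?c *
       (h (restrict (p(t := y)) J) * g (pin (p(t := y)) a) (pin (p(t := y)) b) ((p(t := y)) t)) \<partial>lborel) \<partial>PiM J (\<lambda>_. lborel))"
    by (rule product_nn_integral_insert[OF J tJ]) measurable
  also have "\<dots> = (\<integral>\<^sup>+p. path_density p (grid J) / ?c * (h p * m (pin p a) (pin p b)) \<partial>PiM J (\<lambda>_. lborel))"
  proof (intro nn_integral_cong)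
    fix p assume "p \<in> space (PiM J (\<lambda>_. lborel :: real measure))"
    then have r: "restrict (p(t := y)) J = p" for y
      using tJ by (auto simp: space_PiM fun_eq_iff PiE_def extensional_def restrict_def)
    have "(\<integral>\<^sup>+y. path_density (p(t := y)) (grid (insert t J)) / ?c *
       (h (restrict (p(t := y)) J) * g (pin (p(t := y)) a) (pin (p(t := y)) b) ((p(t := y)) t)) \<partial>lborel) =
       (\<integral>\<^sup>+y. (h p / ?c) * (g (pin p a) (pin p b) y * path_density (p(t := y)) (grid (insert t J))) \<partial>lborel)"
      unfolding r using ab by (simp add: pin_upd divide_ennreal_def mult_ac)
    also have "\<dots> = (h p / ?c) * (\<integral>\<^sup>+y. (g (pin p a) (pin p b) y * path_density (p(t := y)) (grid (insert t J))) \<partial>lborel)"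
    proof (rule nn_integral_cmult)
      have "(\<lambda>y. p(t := y)) \<in> measurable lborel (PiM (insert t J) (\<lambda>_. lborel))"
        by (rule measurable_fun_upd[where J=J]) (use \<open>p \<in> space _\<close> in auto)
      then have "(\<lambda>y. path_density (p(t := y)) (grid (insert t J))) \<in> borel_measurable lborel"
        by (rule measurable_compose) (use J in \<open>auto intro!: grid_measurable\<close>)
      then show "(\<lambda>y. g (pin p a) (pin p b) y * path_density (p(t := y)) (grid (insert t J))) \<in> borel_measurable lborel"
        using g1 by (intro borel_measurable_times_ennreal) simp_all
    qed
    also have "\<dots> = (h p / ?c) * (m (pin p a) (pin p b) * path_density p (grid J))"
      by (subst nn_integral_path_density_insert[OF J ab gap g1 gm t]) auto
    finally show "(\<integral>\<^sup>+y. path_density (p(t := y)) (grid (insert t J)) / ?c *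
       (h (restrict (p(t := y)) J) * g (pin (p(t := y)) a) (pin (p(t := y)) b) ((p(t := y)) t)) \<partial>lborel) =
       path_density p (grid J) / ?c * (h p * m (pin p a) (pin p b))"
      by (simp add: divide_ennreal_def mult_ac)
  qed
  also have "\<dots> = (\<integral>\<^sup>+p. h p * m (pin p a) (pin p b) \<partial>fdd J)"
    unfolding fdd_def by (subst nn_integral_density) measurable
  finally show ?thesis .
qed

text \<open>Insertion with \<open>g\<close> and \<open>m\<close> equal to 1: the identity required
  for the kernels is then the convolution property, translated by \<open>x\<close>.\<close>

lemma fdd_restrict_insert:
  assumes J: "finite J" and t: "0 < t" "t < T" "t \<notin> J"
  shows "fdd J = distr (fdd (insert t J)) (PiM J (\<lambda>_. borel)) (\<lambda>p. restrict p J)"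
proof (rule measure_eqI)
  show "sets (fdd J) = sets (distr (fdd (insert t J)) (PiM J (\<lambda>_. borel)) (\<lambda>p. restrict p J))"
    by (simp add: sets_fdd)
next
  fix B assume B: "B \<in> sets (fdd J)"
  let ?A = "insert 0 (insert T J)"
  \<comment> \<open>The neighbours of \<open>t\<close> in the grid. Both exist because
    \<open>0\<close> and \<open>T\<close> always belong to it.\<close>
  define a where "a = Max {c \<in> ?A. c < t}"
  define b where "b = Min {c \<in> ?A. t < c}"
  have fa: "finite {c \<in> ?A. c < t}" and fb: "finite {c \<in> ?A. t < c}" using J by auto
  have na: "{c \<in> ?A. c < t} \<noteq> {}" and nb: "{c \<in> ?A. t < c} \<noteq> {}" using t by auto
  have a: "a \<in> ?A" "a < t" using Max_in[OF fa na] by (auto simp: a_def)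
  have b: "b \<in> ?A" "t < b" using Min_in[OF fb nb] by (auto simp: b_def)
  have gap: "c \<le> a \<or> b \<le> c" if "c \<in> ?A" for c
  proof -
    have "c \<noteq> t" using that t by auto
    then show ?thesis using Max_ge[OF fa] Min_le[OF fb] that by (auto simp: a_def b_def neq_iff)
  qed
  have conv: "(\<integral>\<^sup>+y. 1 * ennreal (q (t - a) (y - x) * q (b - t) (w - y)) \<partial>lborel) = 1 * ennreal (q (b - a) (w - x))" for x w
  proof -
    have [measurable]: "q (t - a) \<in> borel_measurable borel" "q (b - t) \<in> borel_measurable borel"
      using a b by (auto intro: q_measurable)
    have "(\<integral>\<^sup>+y. ennreal (q (t - a) (y - x) * q (b - t) (w - y)) \<partial>lborel) =
        (\<integral>\<^sup>+y. ennreal (q (t - a) (x + 1 * y - x) * q (b - t) (w - (x + 1 * y))) \<partial>lborel)"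
      by (subst nn_integral_real_affine[where c=1 and t=x]) auto
    also have "\<dots> = (\<integral>\<^sup>+y. ennreal (q (t - a) y * q (b - t) ((w - x) - y)) \<partial>lborel)"
      by (simp add: algebra_simps)
    also have "\<dots> = ennreal (q (b - a) (w - x))"
      using a b by (subst q_convolution) auto
    finally show ?thesis by simp
  qed
  have Bs[measurable]: "B \<in> sets (PiM J (\<lambda>_. borel))" using B by (simp add: sets_fdd)
  have r: "(\<lambda>p. restrict p J) \<in> measurable (fdd (insert t J)) (PiM J (\<lambda>_. borel))"
    unfolding measurable_cong_sets[OF sets_fdd refl] by (intro measurable_restrict_subset) auto
  have "emeasure (fdd J) B = (\<integral>\<^sup>+p. indicator B p * 1 \<partial>fdd J)"
    using B by simp
  also have "\<dots> = (\<integral>\<^sup>+p. indicator B (restrict p J) * 1 \<partial>fdd (insert t J))"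
    by (rule nn_integral_fdd_insert[OF J a(1) b(1) a(2) b(2) gap _ _ conv t(1,2), symmetric]) (use Bs in auto)
  also have "\<dots> = (\<integral>\<^sup>+p. indicator B p \<partial>distr (fdd (insert t J)) (PiM J (\<lambda>_. borel)) (\<lambda>p. restrict p J))"
    by (subst nn_integral_distr[OF r]) auto
  also have "\<dots> = emeasure (distr (fdd (insert t J)) (PiM J (\<lambda>_. borel)) (\<lambda>p. restrict p J)) B"
    by (rule nn_integral_indicator) simp
  finally show "emeasure (fdd J) B = emeasure (distr (fdd (insert t J)) (PiM J (\<lambda>_. borel)) (\<lambda>p. restrict p J)) B" .
qed

lemma fdd_restrict:
  assumes "finite K" "finite J" "J \<inter> K = {}" "K \<subseteq> {0<..<T}"
  shows "fdd J = distr (fdd (J \<union> K)) (PiM J (\<lambda>_. borel)) (\<lambda>p. restrict p J)"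
  using assms
proof (induction K)
  case empty
  have "distr (fdd J) (PiM J (\<lambda>_. borel)) (\<lambda>p. restrict p J) = distr (fdd J) (fdd J) (\<lambda>p. p)"
  proof (rule distr_cong)
    fix p assume "p \<in> space (fdd J)"
    then have "p \<in> extensional J"
      using sets_eq_imp_space_eq[OF sets_fdd[of J]] by (auto simp: space_PiM PiE_iff)
    then show "restrict p J = p" by (rule extensional_restrict)
  qed (simp_all add: sets_fdd)
  then show ?case
    unfolding Un_empty_right by (simp only: distr_id)
next
  case (insert t K)
  have m1: "(\<lambda>p. restrict p (J \<union> K)) \<in> measurable (fdd (insert t (J \<union> K))) (PiM (J \<union> K) (\<lambda>_. borel))"
    unfolding measurable_cong_sets[OF sets_fdd refl] by (intro measurable_restrict_subset) auto
  have m2: "(\<lambda>p. restrict p J) \<in> measurable (PiM (J \<union> K) (\<lambda>_. borel)) (PiM J (\<lambda>_. borel))"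
    by (intro measurable_restrict_subset) auto
  have A: "fdd (J \<union> K) = distr (fdd (insert t (J \<union> K))) (PiM (J \<union> K) (\<lambda>_. borel)) (\<lambda>p. restrict p (J \<union> K))"
    using insert by (intro fdd_restrict_insert) auto
  have B: "fdd J = distr (fdd (J \<union> K)) (PiM J (\<lambda>_. borel)) (\<lambda>p. restrict p J)"
    using insert by (intro insert.IH) auto
  have "fdd J = distr (distr (fdd (insert t (J \<union> K))) (PiM (J \<union> K) (\<lambda>_. borel)) (\<lambda>p. restrict p (J \<union> K)))
      (PiM J (\<lambda>_. borel)) (\<lambda>p. restrict p J)"
    by (rule B[unfolded A])
  also have "\<dots> = distr (fdd (insert t (J \<union> K))) (PiM J (\<lambda>_. borel)) (\<lambda>p. restrict p J)"
    by (subst distr_distr[OF m2 m1]) (auto simp: comp_def Int_absorb1)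
  finally show ?case unfolding Un_insert_right Un_insert_left .
qed

lemma prob_space_fdd_empty: "prob_space (fdd {})"
proof
  have "grid {} = [0, T]" using T_pos by (simp add: grid_def)
  then have "path_density p (grid {}) = ennreal (q T z)" for p using T_pos by (simp add: pin_def)
  then have "fdd {} = density (PiM {} (\<lambda>_. lborel)) (\<lambda>_. 1)"
    using q_pos[OF T_pos, of z] by (simp add: fdd_def ennreal_divide_self)
  then show "emeasure (fdd {}) (space (fdd {})) = 1"
    by (simp add: density_1 space_PiM emeasure_PiM_empty)
qed

text \<open>Restriction preserves the total mass, so it can be read off at the empty set of times,
  where the density is \<open>q T z\<close> divided by itself.\<close>

lemma prob_space_fdd:
  assumes "finite J" "J \<subseteq> {0<..<T}" shows "prob_space (fdd J)"
proof -
  have "fdd {} = distr (fdd ({} \<union> J)) (PiM {} (\<lambda>_. borel)) (\<lambda>p. restrict p {})"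
    using assms by (intro fdd_restrict) auto
  moreover have "(\<lambda>p. restrict p {}) \<in> measurable (fdd J) (PiM {} (\<lambda>_. borel :: real measure))"
    unfolding measurable_cong_sets[OF sets_fdd refl] by (intro measurable_restrict_subset) auto
  ultimately show ?thesis
    using prob_space_fdd_empty by (metis prob_space_distrD sup_bot_left)
qed

end

section \<open>The law of the bridge on all times as a projective limit\<close>

sublocale convolution_bridge \<subseteq> polish_projective "{0<..<T}" fdd
proof (intro polish_projective.intro projective_family.intro)
  fix J H :: "real set" assume JH: "J \<subseteq> H" "finite H" "H \<subseteq> {0<..<T}"
  then have "fdd J = distr (fdd (J \<union> (H - J))) (PiM J (\<lambda>_. borel)) (\<lambda>p. restrict p J)"
    by (intro fdd_restrict) (auto intro: finite_subset)
  moreover have "J \<union> (H - J) = H" using JH by auto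
  ultimately show "fdd J = distr (fdd H) (PiM J (\<lambda>_. borel)) (\<lambda>f. restrict f J)"
    by (simp only:)
next
  fix J :: "real set" assume "finite J" "J \<subseteq> {0<..<T}"
  then show "prob_space (fdd J)" by (rule prob_space_fdd)
qed

section \<open>Conditioning on the outside of an interval\<close>

context convolution_bridge
begin

lemma restrict_measurable_lim:
  assumes "J \<subseteq> {0<..<T}"
  shows "(\<lambda>p. restrict p J) \<in> measurable lim (PiM J (\<lambda>_. borel))"
  unfolding measurable_cong_sets[OF sets_lim refl] using assms by (rule measurable_restrict_subset)

lemma distr_lim_fdd:
  assumes J: "J \<subseteq> {0<..<T}" "finite J"
  shows "distr lim (PiM J (\<lambda>_. borel)) (\<lambda>p. restrict p J) = fdd J"
proof (rule measure_eqI)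
  show "sets (distr lim (PiM J (\<lambda>_. borel)) (\<lambda>p. restrict p J)) = sets (fdd J)"
    by (simp add: sets_fdd)
next
  fix B assume "B \<in> sets (distr lim (PiM J (\<lambda>_. borel)) (\<lambda>p. restrict p J))"
  then have B: "B \<in> sets (PiM J (\<lambda>_. borel))" by simp
  have "emeasure (distr lim (PiM J (\<lambda>_. borel)) (\<lambda>p. restrict p J)) B =
      emeasure lim ((\<lambda>p. restrict p J) -` B \<inter> space lim)"
    by (rule emeasure_distr[OF restrict_measurable_lim[OF J(1)] B])
  also have "(\<lambda>p. restrict p J) -` B \<inter> space lim = prod_emb {0<..<T} (\<lambda>_. borel) J B"
    by (simp add: prod_emb_def space_PiM)
  also have "emeasure lim \<dots> = emeasure (fdd J) B"
    using J B by (rule emeasure_lim_emb)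
  finally show "emeasure (distr lim (PiM J (\<lambda>_. borel)) (\<lambda>p. restrict p J)) B = emeasure (fdd J) B" .
qed

lemma pin_restrict: "(0 < r \<Longrightarrow> r < T \<Longrightarrow> r \<in> J) \<Longrightarrow> pin (restrict p J) r = pin p r"
  by (auto simp: pin_def)

lemma pin_measurable_lim: "(\<lambda>p. pin p r) \<in> borel_measurable lim"
  unfolding measurable_cong_sets[OF sets_lim refl] by (rule pin_measurable) auto

lemma nn_integral_lim_insert:
  assumes J: "finite J" "J \<subseteq> {0<..<T}"
    and ab: "a \<in> insert 0 (insert T J)" "b \<in> insert 0 (insert T J)" "a < t" "t < b"
    and gap: "\<And>c. c \<in> insert 0 (insert T J) \<Longrightarrow> c \<le> a \<or> b \<le> c"
    and g: "(\<lambda>(x, w, y). g x w y) \<in> borel_measurable (borel \<Otimes>\<^sub>M borel \<Otimes>\<^sub>M borel)"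
    and m: "(\<lambda>(x, w). m x w) \<in> borel_measurable (borel \<Otimes>\<^sub>M borel)"
    and gm: "\<And>x w. (\<integral>\<^sup>+y. g x w y * ennreal (q (t - a) (y - x) * q (b - t) (w - y)) \<partial>lborel) =
      m x w * ennreal (q (b - a) (w - x))"
    and t: "0 < t" "t < T"
    and h: "h \<in> borel_measurable (PiM J (\<lambda>_. borel))"
  shows "(\<integral>\<^sup>+p. h (restrict p J) * g (pin p a) (pin p b) (p t) \<partial>lim) =
    (\<integral>\<^sup>+p. h (restrict p J) * m (pin p a) (pin p b) \<partial>lim)"
proof -
  let ?J = "insert t J"
  have J': "?J \<subseteq> {0<..<T}" "finite ?J" using J t by auto
  have pa: "pin (restrict p J) a = pin p a" "pin (restrict p J) b = pin p b"
    "pin (restrict p ?J) a = pin p a" "pin (restrict p ?J) b = pin p b" for p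
    using ab by (auto intro!: pin_restrict)
  have pins: "(\<lambda>p. pin p a) \<in> borel_measurable (PiM ?J (\<lambda>_. borel))"
     "(\<lambda>p. pin p b) \<in> borel_measurable (PiM ?J (\<lambda>_. borel))"
     "(\<lambda>p. pin p a) \<in> borel_measurable (PiM J (\<lambda>_. borel))"
     "(\<lambda>p. pin p b) \<in> borel_measurable (PiM J (\<lambda>_. borel))"
    using ab by (auto intro!: pin_measurable)
  have gmeas: "(\<lambda>p. g (pin p a) (pin p b) (p t)) \<in> borel_measurable (PiM ?J (\<lambda>_. borel))"
    using measurable_compose[OF _ g, of "\<lambda>p. (pin p a, pin p b, p t)" "PiM ?J (\<lambda>_. borel)"] pins by simp
  have mmeas: "(\<lambda>p. m (pin p a) (pin p b)) \<in> borel_measurable (PiM J (\<lambda>_. borel))"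
    using measurable_compose[OF _ m, of "\<lambda>p. (pin p a, pin p b)" "PiM J (\<lambda>_. borel)"] pins by simp
  have rJ: "(\<lambda>p. restrict p J) \<in> measurable (PiM ?J (\<lambda>_. borel)) (PiM J (\<lambda>_. borel))"
    by (rule measurable_restrict_subset) auto
  have "(\<integral>\<^sup>+p. h (restrict p J) * g (pin p a) (pin p b) (p t) \<partial>lim) =
      (\<integral>\<^sup>+p. h (restrict p J) * g (pin p a) (pin p b) (p t) \<partial>distr lim (PiM ?J (\<lambda>_. borel)) (\<lambda>p. restrict p ?J))"
  proof (subst nn_integral_distr[OF restrict_measurable_lim[OF J'(1)]])
    show "(\<lambda>p. h (restrict p J) * g (pin p a) (pin p b) (p t)) \<in>
        borel_measurable (distr lim (PiM ?J (\<lambda>_. borel)) (\<lambda>p. restrict p ?J))"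
      unfolding measurable_distr_eq1 by (intro borel_measurable_times_ennreal gmeas measurable_compose[OF rJ h])
    have "restrict (restrict p ?J) J = restrict p J" for p :: "real \<Rightarrow> real"
      by (auto simp: fun_eq_iff)
    then show "(\<integral>\<^sup>+p. h (restrict p J) * g (pin p a) (pin p b) (p t) \<partial>lim) =
      (\<integral>\<^sup>+p. h (restrict (restrict p ?J) J) * g (pin (restrict p ?J) a) (pin (restrict p ?J) b) (restrict p ?J t) \<partial>lim)"
      unfolding pa by simp
  qed
  also have "\<dots> = (\<integral>\<^sup>+p. h p * m (pin p a) (pin p b) \<partial>fdd J)"
    unfolding distr_lim_fdd[OF J'] by (rule nn_integral_fdd_insert[OF J(1) ab gap g m gm t h])
  also have "\<dots> = (\<integral>\<^sup>+p. h p * m (pin p a) (pin p b) \<partial>distr lim (PiM J (\<lambda>_. borel)) (\<lambda>p. restrict p J))"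
    unfolding distr_lim_fdd[OF J(2,1)] ..
  also have "\<dots> = (\<integral>\<^sup>+p. h (restrict p J) * m (pin p a) (pin p b) \<partial>lim)"
    using h mmeas by (subst nn_integral_distr[OF restrict_measurable_lim[OF J(2)]]) (simp_all only: pa borel_measurable_times_ennreal measurable_distr_eq1)
  finally show ?thesis .
qed

text \<open>Expresses a weighted integral over an event of the outer coordinates as the value of a
  measure, so that an equality of such integrals can be proved on a generator.\<close>

lemma emeasure_distr_density_lim:
  assumes R: "R \<subseteq> {0<..<T}" and f: "f \<in> borel_measurable lim" and B: "B \<in> sets (PiM R (\<lambda>_. borel))"
  shows "emeasure (distr (density lim f) (PiM R (\<lambda>_. borel)) (\<lambda>p. restrict p R)) B =
    (\<integral>\<^sup>+p. indicator B (restrict p R) * f p \<partial>lim)"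
proof -
  have r: "(\<lambda>p. restrict p R) \<in> measurable (density lim f) (PiM R (\<lambda>_. borel))"
    using restrict_measurable_lim[OF R] by simp
  have "(\<lambda>p. restrict p R) -` B \<inter> space lim \<in> sets lim"
    using restrict_measurable_lim[OF R] B by (rule measurable_sets)
  then have "emeasure (distr (density lim f) (PiM R (\<lambda>_. borel)) (\<lambda>p. restrict p R)) B =
    (\<integral>\<^sup>+p. f p * indicator ((\<lambda>p. restrict p R) -` B \<inter> space lim) p \<partial>lim)"
    by (subst emeasure_distr[OF r B]) (simp add: emeasure_density f)
  also have "\<dots> = (\<integral>\<^sup>+p. indicator B (restrict p R) * f p \<partial>lim)"
    by (intro nn_integral_cong) (simp add: indicator_def)
  finally show ?thesis .
qed

definition outer_times :: "real \<Rightarrow> real \<Rightarrow> real set" where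
  "outer_times a b = {r. 0 < r \<and> r < T \<and> (r \<le> a \<or> b \<le> r)}"

text \<open>Both sides are the values at \<open>B\<close> of measures on the paths over the outer
  times. They agree on finite-dimensional rectangles by the insertion of \<open>t\<close>, and
  \<open>fin\<close> makes the first measure finite, so that rectangles determine it.\<close>

lemma nn_integral_lim_outer:
  assumes ab: "0 \<le> a" "a < t" "t < b" "b \<le> T"
    and g: "(\<lambda>(x, w, y). g x w y) \<in> borel_measurable (borel \<Otimes>\<^sub>M borel \<Otimes>\<^sub>M borel)"
    and m: "(\<lambda>(x, w). m x w) \<in> borel_measurable (borel \<Otimes>\<^sub>M borel)"
    and gm: "\<And>x w. (\<integral>\<^sup>+y. g x w y * ennreal (q (t - a) (y - x) * q (b - t) (w - y)) \<partial>lborel) =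
      m x w * ennreal (q (b - a) (w - x))"
    and fin: "(\<integral>\<^sup>+p. g (pin p a) (pin p b) (p t) \<partial>lim) < \<infinity>"
    and B: "B \<in> sets (PiM (outer_times a b) (\<lambda>_. borel))"
  shows "(\<integral>\<^sup>+p. indicator B (restrict p (outer_times a b)) * g (pin p a) (pin p b) (p t) \<partial>lim) =
    (\<integral>\<^sup>+p. indicator B (restrict p (outer_times a b)) * m (pin p a) (pin p b) \<partial>lim)"
proof -
  let ?R = "outer_times a b"
  define f1 where "f1 p = g (pin p a) (pin p b) (p t)" for p
  define f2 where "f2 p = m (pin p a) (pin p b)" for p
  define P where "P f = distr (density lim f) (PiM ?R (\<lambda>_. borel)) (\<lambda>p. restrict p ?R)" for f
  have R: "?R \<subseteq> {0<..<T}" by (auto simp: outer_times_def)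
  have "(\<lambda>p. p t) \<in> borel_measurable lim"
    unfolding measurable_cong_sets[OF sets_lim refl] using ab by (intro measurable_component_singleton) auto
  then have f1: "f1 \<in> borel_measurable lim"
    using measurable_compose[OF _ g, of "\<lambda>p. (pin p a, pin p b, p t)" lim] pin_measurable_lim
    unfolding f1_def by simp
  have f2: "f2 \<in> borel_measurable lim"
    using measurable_compose[OF _ m, of "\<lambda>p. (pin p a, pin p b)" lim] pin_measurable_lim
    unfolding f2_def by simp
  have "P f1 = P f2"
  proof (rule measure_eqI_PiM_infinite)
    show "sets (P f1) = sets (PiM ?R (\<lambda>_. borel))" "sets (P f2) = sets (PiM ?R (\<lambda>_. borel))"
      by (simp_all add: P_def)
  next
    fix A J assume J: "finite J" "J \<subseteq> ?R" and A: "\<And>i. i \<in> J \<Longrightarrow> A i \<in> sets (borel :: real measure)"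
    \<comment> \<open>The times \<open>a\<close> and \<open>b\<close> are added when they are
      interior: they must be the neighbours of \<open>t\<close> in the grid, even if the rectangle
      does not constrain them.\<close>
    define J' where "J' = J \<union> ({a, b} \<inter> {0<..<T})"
    define h :: "(real \<Rightarrow> real) \<Rightarrow> ennreal" where "h p = indicator (Pi\<^sub>E J A) (restrict p J)" for p
    have E: "Pi\<^sub>E J A \<in> sets (PiM J (\<lambda>_. borel))" using J A by (intro sets_PiM_I_finite)
    have PE: "prod_emb ?R (\<lambda>_. borel) J (Pi\<^sub>E J A) \<in> sets (PiM ?R (\<lambda>_. borel))"
      using J E by (intro measurable_prod_emb)
    have h: "h \<in> borel_measurable (PiM J' (\<lambda>_. borel))"
      unfolding h_def using E
      by (intro measurable_compose[OF measurable_restrict_subset borel_measurable_indicator]) (auto simp: J'_def)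
    have ind: "indicator (prod_emb ?R (\<lambda>_. borel) J (Pi\<^sub>E J A)) (restrict p ?R) = h (restrict p J')" for p
    proof -
      have "restrict (restrict p ?R) J = restrict p J" "restrict (restrict p J') J = restrict p J"
        using J by (auto simp: fun_eq_iff J'_def)
      then show ?thesis
        unfolding h_def prod_emb_def by (auto simp: indicator_def space_PiM)
    qed
    have "(\<integral>\<^sup>+p. h (restrict p J') * g (pin p a) (pin p b) (p t) \<partial>lim) =
        (\<integral>\<^sup>+p. h (restrict p J') * m (pin p a) (pin p b) \<partial>lim)"
    proof (rule nn_integral_lim_insert[OF _ _ _ _ _ _ _ g m gm _ _ h])
      show "finite J'" "J' \<subseteq> {0<..<T}" using J R by (auto simp: J'_def)
      show "a \<in> insert 0 (insert T J')" "b \<in> insert 0 (insert T J')" using ab by (auto simp: J'_def)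
      show "c \<le> a \<or> b \<le> c" if "c \<in> insert 0 (insert T J')" for c
        using that ab J by (auto simp: J'_def outer_times_def)
    qed (use ab in auto)
    then show "emeasure (P f1) (prod_emb ?R (\<lambda>_. borel) J (Pi\<^sub>E J A)) = emeasure (P f2) (prod_emb ?R (\<lambda>_. borel) J (Pi\<^sub>E J A))"
      unfolding P_def emeasure_distr_density_lim[OF R f1 PE] emeasure_distr_density_lim[OF R f2 PE] ind
      by (simp add: f1_def f2_def)
  next
    show "finite_measure (P f1)"
    proof
      have s: "space (P f1) = space (PiM ?R (\<lambda>_. borel))" by (simp add: P_def)
      have "emeasure (P f1) (space (P f1)) = (\<integral>\<^sup>+p. indicator (space (PiM ?R (\<lambda>_. borel))) (restrict p ?R) * f1 p \<partial>lim)"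
        unfolding s unfolding P_def by (rule emeasure_distr_density_lim[OF R f1]) simp
      also have "\<dots> = (\<integral>\<^sup>+p. f1 p \<partial>lim)"
        by (intro nn_integral_cong) (simp add: space_PiM)
      finally show "emeasure (P f1) (space (P f1)) \<noteq> \<infinity>"
        using fin by (simp add: f1_def)
    qed
  qed
  then have "emeasure (P f1) B = emeasure (P f2) B" by simp
  then show ?thesis
    unfolding P_def emeasure_distr_density_lim[OF R f1 B] emeasure_distr_density_lim[OF R f2 B]
    by (simp add: f1_def f2_def)
qed

text \<open>\<open>F\<close> ranges over all fields between the one generated by the two pins and
  the one of all outer coordinates, because the final process generates a field of its own. Each
  event of \<open>F\<close> is the preimage of some \<open>B\<close>, so the two integrals over it
  agree, which characterises the conditional expectation.\<close>

lemma real_cond_exp_lim: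
  assumes ab: "0 \<le> a" "a < t" "t < b" "b \<le> T"
    and g: "(\<lambda>(x, w, y). g x w y) \<in> borel_measurable (borel \<Otimes>\<^sub>M borel \<Otimes>\<^sub>M borel)" "\<And>x w y. g x w y \<ge> 0"
    and m: "(\<lambda>(x, w). m x w) \<in> borel_measurable (borel \<Otimes>\<^sub>M borel)" "\<And>x w. m x w \<ge> 0"
    and gm: "\<And>x w. (\<integral>\<^sup>+y. ennreal (g x w y * (q (t - a) (y - x) * q (b - t) (w - y))) \<partial>lborel) =
      ennreal (m x w * q (b - a) (w - x))"
    and int: "integrable lim (\<lambda>p. g (pin p a) (pin p b) (p t))"
    and F: "subalgebra lim F"
      "sets F \<subseteq> sets (vimage_algebra (space lim) (\<lambda>p. restrict p (outer_times a b)) (PiM (outer_times a b) (\<lambda>_. borel)))"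
    and pins: "(\<lambda>p. pin p a) \<in> borel_measurable F" "(\<lambda>p. pin p b) \<in> borel_measurable F"
  shows "AE p in lim. real_cond_exp lim F (\<lambda>p. g (pin p a) (pin p b) (p t)) p = m (pin p a) (pin p b)"
proof -
  interpret finite_measure_subalgebra lim F
    using F(1) by unfold_locales
  let ?R = "outer_times a b"
  let ?f = "\<lambda>p. g (pin p a) (pin p b) (p t)" and ?m = "\<lambda>p. m (pin p a) (pin p b)"
  have mF: "?m \<in> borel_measurable F"
    using measurable_compose[OF _ m(1), of "\<lambda>p. (pin p a, pin p b)" F] pins by simp
  then have mM: "?m \<in> borel_measurable lim" by (rule measurable_from_subalg[OF F(1)])
  have fM: "?f \<in> borel_measurable lim" using int by auto
  have key: "(\<integral>\<^sup>+p. indicator B (restrict p ?R) * ennreal (?f p) \<partial>lim) =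
      (\<integral>\<^sup>+p. indicator B (restrict p ?R) * ennreal (?m p) \<partial>lim)"
    if B: "B \<in> sets (PiM ?R (\<lambda>_. borel))" for B
  proof (rule nn_integral_lim_outer[OF ab, where g="\<lambda>x w y. ennreal (g x w y)" and m="\<lambda>x w. ennreal (m x w)", OF _ _ _ _ B])
    show "(\<lambda>(x, w, y). ennreal (g x w y)) \<in> borel_measurable (borel \<Otimes>\<^sub>M borel \<Otimes>\<^sub>M borel)"
      using measurable_compose[OF g(1) measurable_ennreal] by (simp add: case_prod_beta)
    show "(\<lambda>(x, w). ennreal (m x w)) \<in> borel_measurable (borel \<Otimes>\<^sub>M borel)"
      using measurable_compose[OF m(1) measurable_ennreal] by (simp add: case_prod_beta)
    show "(\<integral>\<^sup>+y. ennreal (g x w y) * ennreal (q (t - a) (y - x) * q (b - t) (w - y)) \<partial>lborel) =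
      ennreal (m x w) * ennreal (q (b - a) (w - x))" for x w
      using gm[of x w] g(2) m(2) ab q_pos by (simp add: ennreal_mult'[symmetric])
    show "(\<integral>\<^sup>+p. ennreal (?f p) \<partial>lim) < \<infinity>"
      using int g(2) by (simp add: integrable_iff_bounded)
  qed
  have ind: "\<exists>B. B \<in> sets (PiM ?R (\<lambda>_. borel)) \<and> A = (\<lambda>p. restrict p ?R) -` B \<inter> space lim" if "A \<in> sets F" for A
  proof -
    have "(\<lambda>p. restrict p ?R) \<in> space lim \<rightarrow> space (PiM ?R (\<lambda>_. borel :: real measure))"
      by (auto simp: space_PiM)
    then show ?thesis using that F(2) by (auto simp: sets_vimage_algebra2)
  qed
  \<comment> \<open>Taking the whole space for \<open>B\<close> transfers integrability from
    \<open>g\<close> to \<open>m\<close>.\<close>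
  have intm: "integrable lim ?m"
  proof (rule integrableI_nonneg[OF mM])
    have "(\<integral>\<^sup>+p. ennreal (?m p) \<partial>lim) = (\<integral>\<^sup>+p. indicator (space (PiM ?R (\<lambda>_. borel))) (restrict p ?R) * ennreal (?m p) \<partial>lim)"
      by (intro nn_integral_cong) (simp add: space_PiM)
    also have "\<dots> = (\<integral>\<^sup>+p. indicator (space (PiM ?R (\<lambda>_. borel))) (restrict p ?R) * ennreal (?f p) \<partial>lim)"
      by (rule key[symmetric]) simp
    also have "\<dots> = (\<integral>\<^sup>+p. ennreal (?f p) \<partial>lim)"
      by (intro nn_integral_cong) (simp add: space_PiM)
    also have "\<dots> < \<infinity>"
      using int g(2) by (simp add: integrable_iff_bounded)
    finally show "(\<integral>\<^sup>+p. ennreal (?m p) \<partial>lim) < \<infinity>" .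
  qed (use m(2) in auto)
  show ?thesis
  proof (rule real_cond_exp_charact[OF _ int intm mF])
    fix A assume A: "A \<in> sets F"
    then have AM[measurable]: "A \<in> sets lim" using F(1) by (auto simp: subalgebra_def)
    obtain B where B: "B \<in> sets (PiM ?R (\<lambda>_. borel))" "A = (\<lambda>p. restrict p ?R) -` B \<inter> space lim"
      using ind[OF A] by auto
    have eq: "(LINT p:A|lim. f p) = enn2real (\<integral>\<^sup>+p. indicator B (restrict p ?R) * ennreal (f p) \<partial>lim)"
      if f: "f \<in> borel_measurable lim" "\<And>p. f p \<ge> 0" for f
    proof -
      have [measurable]: "f \<in> borel_measurable lim" by fact
      have "(LINT p:A|lim. f p) = enn2real (\<integral>\<^sup>+p. ennreal (indicator A p *\<^sub>R f p) \<partial>lim)"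
        unfolding set_lebesgue_integral_def using f(2) by (intro integral_eq_nn_integral) auto
      also have "(\<integral>\<^sup>+p. ennreal (indicator A p *\<^sub>R f p) \<partial>lim) = (\<integral>\<^sup>+p. indicator B (restrict p ?R) * ennreal (f p) \<partial>lim)"
        using B(2) by (intro nn_integral_cong) (auto simp: indicator_def)
      finally show ?thesis .
    qed
    show "(LINT p:A|lim. ?f p) = (LINT p:A|lim. ?m p)"
      by (simp only: eq[OF fM g(2)] eq[OF mM m(2)] key[OF B(1)])
  qed
qed

end

section \<open>The Meixner bridge\<close>

lemma integrable_power2_lin:
  fixes f g :: "'a \<Rightarrow> real"
  assumes [measurable]: "f \<in> borel_measurable M" "g \<in> borel_measurable M"
    and "integrable M (\<lambda>x. (f x)\<^sup>2)" "integrable M (\<lambda>x. (g x)\<^sup>2)"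
  shows "integrable M (\<lambda>x. (\<alpha> * f x + \<beta> * g x)\<^sup>2)"
proof (rule Bochner_Integration.integrable_bound)
  show "integrable M (\<lambda>x. 2 * \<alpha>\<^sup>2 * (f x)\<^sup>2 + 2 * \<beta>\<^sup>2 * (g x)\<^sup>2)"
    using assms(3,4) by (intro Bochner_Integration.integrable_add integrable_mult_right)
  have "(a + b)\<^sup>2 \<le> 2 * a\<^sup>2 + 2 * b\<^sup>2" for a b :: real
    using zero_le_power2[of "a - b"] by (simp add: power2_sum power2_diff)
  from this[of "\<alpha> * f _" "\<beta> * g _"]
  show "AE x in M. norm ((\<alpha> * f x + \<beta> * g x)\<^sup>2) \<le> norm (2 * \<alpha>\<^sup>2 * (f x)\<^sup>2 + 2 * \<beta>\<^sup>2 * (g x)\<^sup>2)"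
    by (simp add: power_mult_distrib mult.assoc)
qed measurable

lemma nn_integral_has_bochner_integral:
  "has_bochner_integral M f I \<Longrightarrow> (\<And>x. f x \<ge> 0) \<Longrightarrow> (\<integral>\<^sup>+x. ennreal (f x) \<partial>M) = ennreal I"
  by (simp add: has_bochner_integral_iff nn_integral_eq_integral)

locale meixner_bridge =
  fixes T z :: real
  assumes horizon_pos: "T > 0"

sublocale meixner_bridge \<subseteq> convolution_bridge meixner_density T z
proof
  fix s t x :: real assume st: "s > 0" "t > 0"
  show "(\<integral>\<^sup>+y. ennreal (meixner_density s y * meixner_density t (x - y)) \<partial>lborel) = ennreal (meixner_density (s + t) x)"
    by (intro nn_integral_has_bochner_integral meixner_density_convolution st)
      (simp add: meixner_density_pos less_imp_le st)
qed (use horizon_pos measurable_meixner_density meixner_density_pos in auto)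

context meixner_bridge
begin

section \<open>Conditional moments of the bridge\<close>

definition bridge_mean :: "real \<Rightarrow> real \<Rightarrow> real \<Rightarrow> real \<Rightarrow> real \<Rightarrow> real" where
  "bridge_mean a t b x w = ((b - t) * x + (t - a) * w) / (b - a)"

text \<open>The values enter only through the slope \<open>(w - x) / (b - a)\<close>. This is why
  the conditional variance of the harness will be a polynomial in one variable.\<close>

definition bridge_var :: "real \<Rightarrow> real \<Rightarrow> real \<Rightarrow> real \<Rightarrow> real \<Rightarrow> real" where
  "bridge_var a t b x w = (t - a) * (b - t) * ((b - a)\<^sup>2 + (w - x)\<^sup>2) / ((b - a)\<^sup>2 * (2 * (b - a) + 1))"

lemma bridge_var_nonneg: "a < t \<Longrightarrow> t < b \<Longrightarrow> bridge_var a t b x w \<ge> 0"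
  by (auto simp: bridge_var_def intro!: divide_nonneg_nonneg mult_nonneg_nonneg add_nonneg_nonneg)

text \<open>The centre \<open>e\<close> is free for three uses: the conditional mean itself gives
  the variance, \<open>0\<close> gives square integrability, and \<open>1\<close> and
  \<open>-1\<close> together give the conditional mean by polarisation.\<close>

lemma nn_integral_bridge:
  assumes atb: "a < t" "t < b"
  shows "(\<integral>\<^sup>+y. ennreal ((y - e)\<^sup>2 * (meixner_density (t - a) (y - x) * meixner_density (b - t) (w - y))) \<partial>lborel) =
    ennreal ((bridge_var a t b x w + (bridge_mean a t b x w - e)\<^sup>2) * meixner_density (b - a) (w - x))"
proof (rule nn_integral_has_bochner_integral)
  let ?p = "\<lambda>v. meixner_density (t - a) v * meixner_density (b - t) ((w - x) - v)"
  let ?d = "meixner_density (b - a) (w - x)"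
  let ?L = "bridge_mean a t b x w"
  define \<mu> where "\<mu> = (t - a) * (w - x) / (b - a)"
  have L: "?L = x + \<mu>"
    using atb by (simp add: bridge_mean_def \<mu>_def divide_simps) (simp add: algebra_simps)
  have st: "t - a > 0" "b - t > 0" and sum: "(t - a) + (b - t) = b - a" using atb by auto
  have "has_bochner_integral lborel (\<lambda>v. (v - \<mu>)\<^sup>2 * ?p v + 2 * (?L - e) * (v * ?p v - \<mu> * ?p v) + (?L - e)\<^sup>2 * ?p v)
     (bridge_var a t b x w * ?d + 2 * (?L - e) * (\<mu> * ?d - \<mu> * ?d) + (?L - e)\<^sup>2 * ?d)"
    using meixner_density_convolution[OF st, of "w - x"] meixner_density_convolution_mean[OF st, of "w - x"]
      meixner_density_convolution_variance[OF st, of "w - x"]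
    unfolding sum \<mu>_def[symmetric] bridge_var_def[symmetric]
    by (intro has_bochner_integral_add has_bochner_integral_diff has_bochner_integral_mult_right)
  moreover have "(v - \<mu>)\<^sup>2 * ?p v + 2 * (?L - e) * (v * ?p v - \<mu> * ?p v) + (?L - e)\<^sup>2 * ?p v = (x + v - e)\<^sup>2 * ?p v" for v
  proof -
    have "(v - \<mu>)\<^sup>2 * P + 2 * (?L - e) * (v * P - \<mu> * P) + (?L - e)\<^sup>2 * P = (x + v - e)\<^sup>2 * P" for P
      unfolding L by (simp add: power2_eq_square algebra_simps)
    then show ?thesis .
  qed
  moreover have "bridge_var a t b x w * ?d + 2 * (?L - e) * (\<mu> * ?d - \<mu> * ?d) + (?L - e)\<^sup>2 * ?d =
      (bridge_var a t b x w + (?L - e)\<^sup>2) * ?d"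
    by (simp add: algebra_simps)
  ultimately have "has_bochner_integral lborel (\<lambda>v. (x + v - e)\<^sup>2 * ?p v) ((bridge_var a t b x w + (?L - e)\<^sup>2) * ?d)"
    by (simp only:)
  then show "has_bochner_integral lborel (\<lambda>y. (y - e)\<^sup>2 * (meixner_density (t - a) (y - x) * meixner_density (b - t) (w - y)))
      ((bridge_var a t b x w + (?L - e)\<^sup>2) * ?d)"
    by (subst lborel_has_bochner_integral_real_affine_iff[of 1 _ _ x]) (simp_all add: algebra_simps)
  show "(y - e)\<^sup>2 * (meixner_density (t - a) (y - x) * meixner_density (b - t) (w - y)) \<ge> 0" for y
    using meixner_density_pos st by (simp add: less_imp_le)
qed

lemma pin_zero: "pin p 0 = 0"
  by (simp add: pin_def)

lemma pin_horizon: "pin p T = z"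
  using horizon_pos by (simp add: pin_def)

text \<open>An interior time \<open>r\<close> is inserted into the empty set of times. Its
  neighbours are the end points, so the conditional second moment is a finite constant.\<close>

lemma integrable_pin_square: "integrable lim (\<lambda>p. (pin p r)\<^sup>2)"
proof (cases "0 < r \<and> r < T")
  case False
  then have "(\<lambda>p. (pin p r)\<^sup>2) = (\<lambda>_. if r \<le> 0 then 0 else z\<^sup>2)" by (auto simp: pin_def)
  then show ?thesis by simp
next
  case True
  let ?m = "\<lambda>x w. ennreal (bridge_var 0 r T x w + (bridge_mean 0 r T x w - 0)\<^sup>2)"
  have "(\<integral>\<^sup>+p. 1 * ennreal ((p r)\<^sup>2) \<partial>lim) = (\<integral>\<^sup>+p. 1 * ?m (pin p 0) (pin p T) \<partial>lim)"
  proof (rule nn_integral_lim_insert[where J="{}" and g="\<lambda>x w y. ennreal (y\<^sup>2)" and a=0 and b=T and t=r and m="?m" and h="\<lambda>_. 1"])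
    show "(\<integral>\<^sup>+y. ennreal (y\<^sup>2) * ennreal (meixner_density (r - 0) (y - x) * meixner_density (T - r) (w - y)) \<partial>lborel) =
      ?m x w * ennreal (meixner_density (T - 0) (w - x))" for x w
    proof -
      have "meixner_density (T - 0) (w - x) \<ge> 0"
        using meixner_density_pos horizon_pos by (simp add: less_imp_le)
      from ennreal_mult''[OF this, symmetric] ennreal_mult'[OF zero_le_power2, symmetric]
      show ?thesis
        using nn_integral_bridge[of 0 r T 0 x w] True by (simp only: diff_zero)
    qed
    show "(\<lambda>(x, w). ?m x w) \<in> borel_measurable (borel \<Otimes>\<^sub>M borel)"
      unfolding bridge_var_def bridge_mean_def case_prod_beta by measurable
  qed (use True in auto)
  also have "\<dots> < \<infinity>"
    using P.emeasure_space_1 unfolding pin_zero pin_horizon by simp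
  finally have "(\<integral>\<^sup>+p. ennreal ((pin p r)\<^sup>2) \<partial>lim) < \<infinity>"
    using True by (simp add: pin_def)
  then show ?thesis
    using pin_measurable_lim by (intro integrableI_nonneg) auto
qed

lemma integrable_pin: "integrable lim (\<lambda>p. pin p r)"
  using pin_measurable_lim integrable_pin_square by (rule P.square_integrable_imp_integrable)

lemma integrable_pin_mult: "integrable lim (\<lambda>p. pin p r * pin p s)"
proof -
  have "integrable lim (\<lambda>p. ((1 * pin p r + 1 * pin p s)\<^sup>2 - (pin p r)\<^sup>2 - (pin p s)\<^sup>2) / 2)"
    by (intro integrable_divide Bochner_Integration.integrable_diff integrable_power2_lin
        integrable_pin_square pin_measurable_lim)
  moreover have "((1 * pin p r + 1 * pin p s)\<^sup>2 - (pin p r)\<^sup>2 - (pin p s)\<^sup>2) / 2 = pin p r * pin p s" for p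
    by (simp add: power2_sum)
  ultimately show ?thesis by simp
qed

lemma integrable_bridge_mean: "integrable lim (\<lambda>p. bridge_mean a t b (pin p a) (pin p b))"
  unfolding bridge_mean_def
  by (intro integrable_divide Bochner_Integration.integrable_add integrable_mult_right integrable_pin)

lemma integrable_pin_minus_bridge_mean:
  "integrable lim (\<lambda>p. (pin p t - bridge_mean a t b (pin p a) (pin p b))\<^sup>2)"
proof -
  have "integrable lim (\<lambda>p. (1 * pin p t + (- 1) * (((b - t) / (b - a)) * pin p a + ((t - a) / (b - a)) * pin p b))\<^sup>2)"
    by (intro integrable_power2_lin integrable_pin_square pin_measurable_lim
        borel_measurable_add borel_measurable_times borel_measurable_const)
  moreover have "1 * x + (- 1) * (((b - t) / (b - a)) * y + ((t - a) / (b - a)) * w) = x - bridge_mean a t b y w" for x y w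
    by (simp add: bridge_mean_def add_divide_distrib)
  ultimately show ?thesis by (simp only:)
qed

lemma
  assumes ab: "0 \<le> a" "a < t" "t < b" "b \<le> T"
    and F: "subalgebra lim F"
      "sets F \<subseteq> sets (vimage_algebra (space lim) (\<lambda>p. restrict p (outer_times a b)) (PiM (outer_times a b) (\<lambda>_. borel)))"
    and pins: "(\<lambda>p. pin p a) \<in> borel_measurable F" "(\<lambda>p. pin p b) \<in> borel_measurable F"
  shows real_cond_exp_bridge_var:
      "AE p in lim. real_cond_exp lim F (\<lambda>p. (pin p t - bridge_mean a t b (pin p a) (pin p b))\<^sup>2) p =
        bridge_var a t b (pin p a) (pin p b)"
    and real_cond_exp_bridge_mean:
      "AE p in lim. real_cond_exp lim F (\<lambda>p. pin p t) p = bridge_mean a t b (pin p a) (pin p b)"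
proof -
  interpret F: finite_measure_subalgebra lim F
    using F(1) by unfold_locales
  have pt: "pin p t = p t" for p using ab by (simp add: pin_def)
  have gen: "AE p in lim. real_cond_exp lim F (\<lambda>p. (pin p t - e (pin p a) (pin p b))\<^sup>2) p =
      bridge_var a t b (pin p a) (pin p b) + (bridge_mean a t b (pin p a) (pin p b) - e (pin p a) (pin p b))\<^sup>2"
    if e: "(\<lambda>(x, w). e x w) \<in> borel_measurable (borel \<Otimes>\<^sub>M borel)"
      and int: "integrable lim (\<lambda>p. (pin p t - e (pin p a) (pin p b))\<^sup>2)" for e
    unfolding pt
  proof (rule real_cond_exp_lim[OF ab, where g="\<lambda>x w y. (y - e x w)\<^sup>2" and
      m="\<lambda>x w. bridge_var a t b x w + (bridge_mean a t b x w - e x w)\<^sup>2", OF _ _ _ _ _ _ F pins])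
    have [measurable]: "(\<lambda>p. e (fst p) (snd p)) \<in> borel_measurable (borel \<Otimes>\<^sub>M borel)"
      using e by (simp add: case_prod_beta)
    have [measurable]: "(\<lambda>p. e (fst p) (fst (snd p))) \<in> borel_measurable (borel \<Otimes>\<^sub>M borel \<Otimes>\<^sub>M borel)"
      using measurable_compose[OF _ e, of "\<lambda>p. (fst p, fst (snd p))" "borel \<Otimes>\<^sub>M borel \<Otimes>\<^sub>M borel"] by simp
    show "(\<lambda>(x, w, y). (y - e x w)\<^sup>2) \<in> borel_measurable (borel \<Otimes>\<^sub>M borel \<Otimes>\<^sub>M borel)"
      unfolding case_prod_beta by measurable
    show "(\<lambda>(x, w). bridge_var a t b x w + (bridge_mean a t b x w - e x w)\<^sup>2) \<in> borel_measurable (borel \<Otimes>\<^sub>M borel)"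
      unfolding case_prod_beta bridge_var_def bridge_mean_def by measurable
    show "integrable lim (\<lambda>p. (p t - e (pin p a) (pin p b))\<^sup>2)"
      using int unfolding pt .
  qed (use ab nn_integral_bridge bridge_var_nonneg in auto)
  have bm: "(\<lambda>(x, w). bridge_mean a t b x w) \<in> borel_measurable (borel \<Otimes>\<^sub>M borel)"
    unfolding case_prod_beta bridge_mean_def by measurable
  show "AE p in lim. real_cond_exp lim F (\<lambda>p. (pin p t - bridge_mean a t b (pin p a) (pin p b))\<^sup>2) p =
        bridge_var a t b (pin p a) (pin p b)"
    using gen[OF bm integrable_pin_minus_bridge_mean] by simp
  \<comment> \<open>\<open>gen\<close> only covers nonnegative functions of the bridge, so the mean is recovered by polarisation.\<close>
  have int: "integrable lim (\<lambda>p. (pin p t - d)\<^sup>2)" for d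
    using integrable_power2_lin[OF pin_measurable_lim, of "\<lambda>_. d" t 1 "-1"] integrable_pin_square by simp
  have *: "AE p in lim. real_cond_exp lim F (\<lambda>p. (pin p t - d)\<^sup>2) p =
      bridge_var a t b (pin p a) (pin p b) + (bridge_mean a t b (pin p a) (pin p b) - d)\<^sup>2" for d
    using int by (intro gen) auto
  have "AE p in lim. real_cond_exp lim F (\<lambda>p. 1 / 4 * ((pin p t - (-1))\<^sup>2 - (pin p t - 1)\<^sup>2)) p =
      1 / 4 * real_cond_exp lim F (\<lambda>p. (pin p t - (-1))\<^sup>2 - (pin p t - 1)\<^sup>2) p"
    by (intro F.real_cond_exp_cmult Bochner_Integration.integrable_diff int)
  moreover have "AE p in lim. real_cond_exp lim F (\<lambda>p. (pin p t - (-1))\<^sup>2 - (pin p t - 1)\<^sup>2) p =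
      real_cond_exp lim F (\<lambda>p. (pin p t - (-1))\<^sup>2) p - real_cond_exp lim F (\<lambda>p. (pin p t - 1)\<^sup>2) p"
    by (intro F.real_cond_exp_diff int)
  ultimately have "AE p in lim. real_cond_exp lim F (\<lambda>p. 1 / 4 * ((pin p t - (-1))\<^sup>2 - (pin p t - 1)\<^sup>2)) p = bridge_mean a t b (pin p a) (pin p b)"
    using *[of "-1"] *[of 1]
  proof eventually_elim
    case (elim p)
    then show ?case by (simp add: power2_eq_square algebra_simps)
  qed
  moreover have "(\<lambda>p. 1 / 4 * ((pin p t - (-1))\<^sup>2 - (pin p t - 1)\<^sup>2)) = (\<lambda>p. pin p t)"
    by (simp add: fun_eq_iff power2_eq_square algebra_simps)
  ultimately show "AE p in lim. real_cond_exp lim F (\<lambda>p. pin p t) p = bridge_mean a t b (pin p a) (pin p b)"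
    by (simp only:)
qed

section \<open>Mean and covariance of the bridge\<close>

definition outer_algebra :: "real \<Rightarrow> real \<Rightarrow> (real \<Rightarrow> real) measure" where
  "outer_algebra a b = vimage_algebra (space lim) (\<lambda>p. restrict p (outer_times a b)) (PiM (outer_times a b) (\<lambda>_. borel))"

lemma subalgebra_outer_algebra: "subalgebra lim (outer_algebra a b)"
proof -
  have "(\<lambda>p. restrict p (outer_times a b)) \<in> measurable lim (PiM (outer_times a b) (\<lambda>_. borel))"
    by (rule restrict_measurable_lim) (auto simp: outer_times_def)
  then have "sets (outer_algebra a b) \<subseteq> sets lim"
    unfolding outer_algebra_def by (auto simp: measurable_iff_sets)
  then show ?thesis by (simp add: subalgebra_def outer_algebra_def)
qed

lemma pin_measurable_outer_algebra:
  assumes "r \<le> a \<or> b \<le> r"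
  shows "(\<lambda>p. pin p r) \<in> borel_measurable (outer_algebra a b)"
proof -
  have "(\<lambda>p. pin p r) \<in> borel_measurable (PiM (outer_times a b) (\<lambda>_. borel))"
    using assms by (intro pin_measurable) (auto simp: outer_times_def)
  then have "(\<lambda>p. pin (restrict p (outer_times a b)) r) \<in> borel_measurable (outer_algebra a b)"
    unfolding outer_algebra_def
    by (rule measurable_compose[rotated]) (rule measurable_vimage_algebra1, auto simp: space_PiM)
  moreover have "pin (restrict p (outer_times a b)) r = pin p r" for p
    using assms by (intro pin_restrict) (auto simp: outer_times_def)
  ultimately show ?thesis by simp
qed

text \<open>Between \<open>0\<close> and \<open>T\<close> no outer times are left, so the
  conditional mean interpolates between the two fixed end values and is constant; its integral is
  the mean.\<close>

lemma expectation_pin: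
  assumes "0 < t" "t < T" shows "P.expectation (\<lambda>p. pin p t) = t * z / T"
proof -
  interpret F: finite_measure_subalgebra lim "outer_algebra 0 T"
    using subalgebra_outer_algebra by unfold_locales
  have "P.expectation (\<lambda>p. pin p t) = P.expectation (real_cond_exp lim (outer_algebra 0 T) (\<lambda>p. pin p t))"
    by (rule F.real_cond_exp_int(2)[symmetric, OF integrable_pin])
  also have "\<dots> = P.expectation (\<lambda>p. bridge_mean 0 t T (pin p 0) (pin p T))"
    using assms by (intro integral_cong_AE real_cond_exp_bridge_mean subalgebra_outer_algebra pin_measurable_outer_algebra
        borel_measurable_cond_exp2 borel_measurable_integrable[OF integrable_bridge_mean]) (auto simp: outer_algebra_def)
  also have "\<dots> = t * z / T"
    using horizon_pos P.prob_space by (simp add: pin_def bridge_mean_def)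
  finally show ?thesis .
qed

definition centred :: "real \<Rightarrow> (real \<Rightarrow> real) \<Rightarrow> real" where
  "centred r p = pin p r - r * z / T"

lemma centred_measurable: "centred r \<in> borel_measurable lim"
  unfolding centred_def using pin_measurable_lim by simp

lemma integrable_centred_mult: "integrable lim (\<lambda>p. centred r p * centred s p)"
  unfolding centred_def using integrable_pin_mult integrable_pin by (simp add: left_diff_distrib right_diff_distrib)

lemma expectation_centred: "0 < t \<Longrightarrow> t < T \<Longrightarrow> P.expectation (centred t) = 0"
  unfolding centred_def using expectation_pin[of t] integrable_pin[of t] P.prob_space by simp

lemma expectation_centred_square:
  assumes "0 < t" "t < T"
  shows "P.expectation (\<lambda>p. (centred t p)\<^sup>2) = t * (T - t) * ((T\<^sup>2 + z\<^sup>2) / (T\<^sup>2 * (2 * T + 1)))"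
proof -
  interpret F: finite_measure_subalgebra lim "outer_algebra 0 T"
    using subalgebra_outer_algebra by unfold_locales
  let ?f = "\<lambda>p. (pin p t - bridge_mean 0 t T (pin p 0) (pin p T))\<^sup>2"
  have var: "(\<lambda>p. bridge_var 0 t T (pin p 0) (pin p T)) = (\<lambda>p. t * (T - t) * ((T\<^sup>2 + z\<^sup>2) / (T\<^sup>2 * (2 * T + 1))))"
    using horizon_pos by (simp add: fun_eq_iff pin_def bridge_var_def)
  have "(centred t p)\<^sup>2 = ?f p" for p
    using horizon_pos by (simp add: centred_def pin_def bridge_mean_def)
  then have "P.expectation (\<lambda>p. (centred t p)\<^sup>2) = P.expectation ?f" by simp
  also have "\<dots> = P.expectation (real_cond_exp lim (outer_algebra 0 T) ?f)"
    by (rule F.real_cond_exp_int(2)[symmetric, OF integrable_pin_minus_bridge_mean])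
  also have "\<dots> = P.expectation (\<lambda>p. bridge_var 0 t T (pin p 0) (pin p T))"
    using assms by (intro integral_cong_AE real_cond_exp_bridge_var subalgebra_outer_algebra pin_measurable_outer_algebra
        borel_measurable_cond_exp2) (auto simp: outer_algebra_def var)
  also have "\<dots> = t * (T - t) * ((T\<^sup>2 + z\<^sup>2) / (T\<^sup>2 * (2 * T + 1)))"
    unfolding var using P.prob_space by simp
  finally show ?thesis .
qed

text \<open>The subtracted mean is linear in time, and interpolation reproduces linear
  functions.\<close>

lemma centred_bridge_mean:
  assumes "a < b"
  shows "bridge_mean a t b (pin p a) (pin p b) - t * z / T =
    (b - t) / (b - a) * centred a p + (t - a) / (b - a) * centred b p"
proof -
  have "t * z / T = (b - t) / (b - a) * (a * z / T) + (t - a) / (b - a) * (b * z / T)"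
  proof -
    have "(b - t) / (b - a) * (a * k) + (t - a) / (b - a) * (b * k) = t * k" for k
      using assms by (simp add: divide_simps) (simp add: algebra_simps)
    from this[of "z / T"] show ?thesis by simp
  qed
  then show ?thesis
    by (simp add: bridge_mean_def centred_def add_divide_distrib right_diff_distrib)
qed

text \<open>After \<open>s\<close> the path is again a bridge, and its centred end value is 0. Hence
  the conditional mean of \<open>centred t\<close> given the times up to \<open>s\<close> is
  \<open>(T - t) / (T - s)\<close> times \<open>centred s\<close>, and the covariance reduces to the
  variance at \<open>s\<close>.\<close>

lemma expectation_centred_mult:
  assumes st: "0 < s" "s \<le> t" "t < T"
  shows "P.expectation (\<lambda>p. centred s p * centred t p) = s * (T - t) * ((T\<^sup>2 + z\<^sup>2) / (T\<^sup>2 * (2 * T + 1)))"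
proof (cases "s = t")
  case True
  then show ?thesis using expectation_centred_square[of t] st by (simp add: power2_eq_square)
next
  case False
  then have lt: "s < t" using st by simp
  interpret F: finite_measure_subalgebra lim "outer_algebra s T"
    using subalgebra_outer_algebra by unfold_locales
  have cs: "centred s \<in> borel_measurable (outer_algebra s T)"
    unfolding centred_def using pin_measurable_outer_algebra[of s s T] by simp
  have cT: "centred T p = 0" for p
    using horizon_pos by (simp add: centred_def pin_def)
  have "AE p in lim. real_cond_exp lim (outer_algebra s T) (\<lambda>p. pin p t - t * z / T) p =
      real_cond_exp lim (outer_algebra s T) (\<lambda>p. pin p t) p - real_cond_exp lim (outer_algebra s T) (\<lambda>p. t * z / T) p"
    by (intro F.real_cond_exp_diff integrable_pin) simp
  moreover have "AE p in lim. real_cond_exp lim (outer_algebra s T) (\<lambda>p. t * z / T) p = t * z / T"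
    by (rule F.real_cond_exp_F_meas) auto
  moreover have "AE p in lim. real_cond_exp lim (outer_algebra s T) (\<lambda>p. pin p t) p = bridge_mean s t T (pin p s) (pin p T)"
    using st lt by (intro real_cond_exp_bridge_mean subalgebra_outer_algebra pin_measurable_outer_algebra)
      (auto simp: outer_algebra_def)
  ultimately have ce: "AE p in lim. real_cond_exp lim (outer_algebra s T) (centred t) p = (T - t) / (T - s) * centred s p"
    unfolding centred_def[of t, abs_def]
  proof eventually_elim
    case (elim p)
    then show ?case using centred_bridge_mean[of s T t p] st lt by (simp add: cT)
  qed
  have "P.expectation (\<lambda>p. centred s p * centred t p) =
      P.expectation (\<lambda>p. centred s p * real_cond_exp lim (outer_algebra s T) (centred t) p)"
    by (rule F.real_cond_exp_intg(2)[symmetric, OF integrable_centred_mult cs centred_measurable])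
  also have "\<dots> = P.expectation (\<lambda>p. (T - t) / (T - s) * (centred s p)\<^sup>2)"
  proof (rule integral_cong_AE)
    show "AE p in lim. centred s p * real_cond_exp lim (outer_algebra s T) (centred t) p = (T - t) / (T - s) * (centred s p)\<^sup>2"
      using ce by eventually_elim (simp add: power2_eq_square)
  qed (use centred_measurable in \<open>auto intro!: borel_measurable_times borel_measurable_cond_exp2\<close>)
  also have "\<dots> = (T - t) / (T - s) * (s * (T - s) * ((T\<^sup>2 + z\<^sup>2) / (T\<^sup>2 * (2 * T + 1))))"
    using expectation_centred_square[of s] st lt by simp
  finally show ?thesis using st lt by simp
qed

end

section \<open>The quadratic harness\<close>

context meixner_bridge
begin

text \<open>For \<open>r \<le> r'\<close> the covariance of the bridge is a constant times
  \<open>r * (T - r')\<close>. This change of time gives \<open>time_change s * (T - time_change t)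
  = T\<^sup>2 * s / ((1 + s) * (1 + t))\<close>, so multiplying the process by \<open>1 + t\<close>
  leaves a constant times \<open>s\<close>.\<close>

definition time_change :: "real \<Rightarrow> real" where
  "time_change t = T * t / (1 + t)"

text \<open>Cancels the constant \<open>(T\<^sup>2 + z\<^sup>2) / (2 * T + 1)\<close> that then
  remains in the covariance.\<close>

definition scale :: real where
  "scale = sqrt ((2 * T + 1) / (T\<^sup>2 + z\<^sup>2))"

definition harness_process :: "real \<Rightarrow> (real \<Rightarrow> real) \<Rightarrow> real" where
  "harness_process t p = scale * (1 + t) * centred (time_change t) p"

lemma time_change_bounds: "t > 0 \<Longrightarrow> 0 < time_change t \<and> time_change t < T"
  using horizon_pos by (simp add: time_change_def divide_simps)

lemma time_change_diff:
  assumes "s > 0" "t > 0"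
  shows "time_change t - time_change s = T * (t - s) / ((1 + s) * (1 + t))"
  using assms by (simp add: time_change_def divide_simps) (simp add: algebra_simps)

lemma time_change_mono: "0 < s \<Longrightarrow> s \<le> t \<Longrightarrow> time_change s \<le> time_change t"
  using time_change_diff[of s t] horizon_pos by (simp add: algebra_simps)

lemma time_change_strict_mono:
  assumes "0 < s" "s < t" shows "time_change s < time_change t"
proof -
  have "T * (t - s) / ((1 + s) * (1 + t)) > 0" using assms horizon_pos by simp
  then show ?thesis using time_change_diff[of s t] assms by simp
qed

lemma scale_pos: "scale > 0"
  using horizon_pos by (simp add: scale_def add_pos_nonneg)

lemma scale_square: "scale\<^sup>2 = (2 * T + 1) / (T\<^sup>2 + z\<^sup>2)"
  unfolding scale_def using horizon_pos by (intro real_sqrt_pow2 divide_nonneg_nonneg add_nonneg_nonneg) auto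

lemma harness_process_measurable: "harness_process t \<in> borel_measurable lim"
  unfolding harness_process_def using centred_measurable by simp

lemma covariance_harness_process:
  assumes "0 < s" "s \<le> t"
  shows "P.expectation (\<lambda>p. harness_process s p * harness_process t p) = s"
proof -
  have "P.expectation (\<lambda>p. harness_process s p * harness_process t p) =
     P.expectation (\<lambda>p. scale\<^sup>2 * (1 + s) * (1 + t) * (centred (time_change s) p * centred (time_change t) p))"
    by (simp add: harness_process_def power2_eq_square mult_ac)
  also have "\<dots> = scale\<^sup>2 * (1 + s) * (1 + t) *
      (time_change s * (T - time_change t) * ((T\<^sup>2 + z\<^sup>2) / (T\<^sup>2 * (2 * T + 1))))"
    using assms time_change_bounds[of s] time_change_bounds[of t] time_change_mono[of s t]
    by (simp add: expectation_centred_mult)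
  also have "\<dots> = s"
  proof -
    have "T - time_change t = T / (1 + t)"
      using assms by (simp add: time_change_def divide_simps) (simp add: algebra_simps)
    moreover have "T\<^sup>2 + z\<^sup>2 > 0" "T > 0" "2 * T + 1 > 0" using horizon_pos by (auto intro: add_pos_nonneg)
    moreover have "(1 + s) * (1 + t) * (T * s / (1 + s) * (T / (1 + t)) / T\<^sup>2) = s"
      using horizon_pos assms by (simp add: power2_eq_square)
    moreover have "n / m * (1 + s) * (1 + t) * (T * s / (1 + s) * (T / (1 + t)) * (m / (T\<^sup>2 * n))) =
        (1 + s) * (1 + t) * (T * s / (1 + s) * (T / (1 + t)) / T\<^sup>2)" if "m > 0" "n > 0" for m n :: real
      using that by simp
    ultimately show ?thesis
      unfolding scale_square time_change_def[of s] by simp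
  qed
  finally show ?thesis .
qed

text \<open>Under the change of time the interpolation weights pick up the factors
  \<open>(1 + s) / (1 + t)\<close> and \<open>(1 + u) / (1 + t)\<close>, which the scaling of the
  process absorbs.\<close>

lemma bridge_mean_harness_process:
  assumes "0 < s" "s < t" "t < u"
  shows "scale * (1 + t) * (bridge_mean (time_change s) (time_change t) (time_change u)
      (pin p (time_change s)) (pin p (time_change u)) - time_change t * z / T) =
    (u - t) / (u - s) * harness_process s p + (t - s) / (u - s) * harness_process u p"
proof -
  have "(time_change u - time_change t) / (time_change u - time_change s) = (u - t) * (1 + s) / ((u - s) * (1 + t))"
    "(time_change t - time_change s) / (time_change u - time_change s) = (t - s) * (1 + u) / ((u - s) * (1 + t))"
    using assms horizon_pos by (simp_all add: time_change_diff divide_simps)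
  note eqs = this
  have E: "bridge_mean (time_change s) (time_change t) (time_change u)
      (pin p (time_change s)) (pin p (time_change u)) - time_change t * z / T =
      (u - t) * (1 + s) / ((u - s) * (1 + t)) * centred (time_change s) p +
      (t - s) * (1 + u) / ((u - s) * (1 + t)) * centred (time_change u) p"
    unfolding eqs[symmetric] using assms by (intro centred_bridge_mean time_change_strict_mono) auto
  show ?thesis
    unfolding E harness_process_def using assms by (simp add: divide_simps) (simp add: algebra_simps)
qed

text \<open>The slope of the bridge between the two times is \<open>(z - Q / scale) / T\<close>,
  affine in \<open>Q\<close>, so one plus its square is a quadratic polynomial in \<open>Q\<close>.
  Its linear coefficient comes from the cross term with \<open>z\<close>, which explains the form of
  \<eta>.\<close>

lemma bridge_var_harness_process:
  fixes p :: "real \<Rightarrow> real" and s t u :: real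
  assumes stu: "0 < s" "s < t" "t < u"
  defines "\<sigma> \<equiv> 1 / (2 * T + 1)"
  defines "\<eta> \<equiv> - 2 * z * scale * \<sigma>"
  defines "Q \<equiv> ((1 + u) * harness_process s p - (1 + s) * harness_process u p) / (u - s)"
  shows "(scale * (1 + t))\<^sup>2 * bridge_var (time_change s) (time_change t) (time_change u)
      (pin p (time_change s)) (pin p (time_change u)) =
    (u - t) * (t - s) / (u * (1 + \<sigma> * s) + \<sigma> - (1 - 2 * \<sigma>) * s) * (1 + \<eta> * Q + \<sigma> * Q\<^sup>2)"
proof -
  let ?a = "time_change s" and ?b = "time_change u" and ?t = "time_change t"
  define \<delta> where "\<delta> = ?b - ?a"
  define \<Delta> where "\<Delta> = pin p ?b - pin p ?a"
  have pos: "1 + s > 0" "1 + t > 0" "1 + u > 0" "u - s > 0" "T > 0" "scale > 0" "2 * T + 1 > 0"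
    using stu horizon_pos scale_pos by auto
  have \<delta>: "\<delta> = T * (u - s) / ((1 + s) * (1 + u))" "\<delta> > 0"
    using stu time_change_diff[of s u] time_change_strict_mono[of s u] by (auto simp: \<delta>_def)
  have N: "T\<^sup>2 + z\<^sup>2 > 0" using horizon_pos by (simp add: add_pos_nonneg)
  have \<sigma>: "\<sigma> > 0" "\<sigma> * (2 * T + 1) = 1" using pos by (simp_all add: \<sigma>_def)
  \<comment> \<open>The choice of \<open>scale\<close> makes the constant term of the quadratic
    polynomial in \<open>Q\<close> equal to 1.\<close>
  have sN: "\<sigma> * scale\<^sup>2 * (T\<^sup>2 + z\<^sup>2) = 1"
    unfolding scale_square \<sigma>_def using N pos by simp
  have "\<Delta> / \<delta> = z / T + (centred ?b p - centred ?a p) / \<delta>"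
    using \<delta>(2) pos unfolding \<Delta>_def \<delta>_def centred_def by (simp add: divide_simps) (simp add: algebra_simps)
  also have "(centred ?b p - centred ?a p) / \<delta> = - Q / (scale * T)"
  proof -
    have "Q = scale * (1 + s) * (1 + u) * (centred ?a p - centred ?b p) / (u - s)"
      unfolding Q_def harness_process_def by (simp add: algebra_simps)
    then show ?thesis using pos unfolding \<delta>(1) by (simp add: divide_simps) (simp add: algebra_simps)
  qed
  finally have D: "\<Delta> / \<delta> = (z - Q / scale) / T" by (simp add: diff_divide_distrib)
  have quad: "1 + (\<Delta> / \<delta>)\<^sup>2 = (1 + \<eta> * Q + \<sigma> * Q\<^sup>2) / (\<sigma> * scale\<^sup>2 * T\<^sup>2)"
  proof -
    have "\<sigma> * scale\<^sup>2 * (T\<^sup>2 + (z - Q / scale)\<^sup>2) = \<sigma> * scale\<^sup>2 * (T\<^sup>2 + z\<^sup>2) - 2 * z * scale * \<sigma> * Q + \<sigma> * Q\<^sup>2"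
      using pos by (simp add: power2_eq_square field_simps)
    also have "\<dots> = 1 + \<eta> * Q + \<sigma> * Q\<^sup>2" unfolding sN \<eta>_def by simp
    finally have *: "1 + \<eta> * Q + \<sigma> * Q\<^sup>2 = \<sigma> * scale\<^sup>2 * (T\<^sup>2 + (z - Q / scale)\<^sup>2)" ..
    show ?thesis unfolding D * using pos \<sigma>(1) by (simp add: power_divide field_simps)
  qed
  \<comment> \<open>The left side collects what the change of time leaves in the denominator; the
    relation \<open>\<sigma> * (2 * T + 1) = 1\<close> turns it into the denominator of the harness
    condition.\<close>
  have den: "(1 + s) * (1 + u) * (2 * \<delta> + 1) * \<sigma> = u * (1 + \<sigma> * s) + \<sigma> - (1 - 2 * \<sigma>) * s"
  proof -
    have "(1 + s) * (1 + u) * (2 * \<delta> + 1) * \<sigma> = (\<sigma> * (2 * T + 1) - \<sigma>) * (u - s) + (1 + s) * (1 + u) * \<sigma>"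
      using pos unfolding \<delta>(1) by (simp add: divide_simps) (simp add: algebra_simps)
    then show ?thesis unfolding \<sigma>(2) by (simp add: algebra_simps)
  qed
  have "bridge_var ?a ?t ?b (pin p ?a) (pin p ?b) = (?t - ?a) * (?b - ?t) * (1 + (\<Delta> / \<delta>)\<^sup>2) / (2 * \<delta> + 1)"
    unfolding bridge_var_def \<delta>_def[symmetric] \<Delta>_def[symmetric]
    using \<delta>(2) by (simp add: divide_simps power_divide) 
  also have "\<dots> = (T * (t - s) / ((1 + s) * (1 + t))) * (T * (u - t) / ((1 + t) * (1 + u))) *
      ((1 + \<eta> * Q + \<sigma> * Q\<^sup>2) / (\<sigma> * scale\<^sup>2 * T\<^sup>2)) / (2 * \<delta> + 1)"
    unfolding quad using stu by (simp add: time_change_diff)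
  finally have "(scale * (1 + t))\<^sup>2 * bridge_var ?a ?t ?b (pin p ?a) (pin p ?b) =
      (scale * (1 + t))\<^sup>2 * ((T * (t - s) / ((1 + s) * (1 + t))) * (T * (u - t) / ((1 + t) * (1 + u))) *
      ((1 + \<eta> * Q + \<sigma> * Q\<^sup>2) / (\<sigma> * scale\<^sup>2 * T\<^sup>2)) / (2 * \<delta> + 1))" by simp
  also have "\<dots> = (u - t) * (t - s) / ((1 + s) * (1 + u) * (2 * \<delta> + 1) * \<sigma>) * (1 + \<eta> * Q + \<sigma> * Q\<^sup>2)"
  proof -
    have "(c * k)\<^sup>2 * ((T * x / (m * k)) * (T * y / (k * n)) * (w / (\<sigma> * c\<^sup>2 * T\<^sup>2)) / d) =
        y * x / (m * n * d * \<sigma>) * w" if "c > 0" "k > 0" "m > 0" "n > 0" "d > 0" for c k m n d x y w :: real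
      using that pos \<sigma>(1) by (simp add: power2_eq_square divide_simps)
    from this[of scale "1 + t" "1 + s" "1 + u" "2 * \<delta> + 1"] show ?thesis
      using pos \<delta>(2) by simp
  qed
  finally show ?thesis unfolding den .
qed

text \<open>The three relations between the parameters make the form depend on the difference
  \<open>A - B\<close> alone: opposite linear coefficients combine, and the cross term with
  coefficient \<open>2 * \<sigma>\<close> completes the square.\<close>

lemma quadratic_form_identity:
  fixes x y s u \<eta> \<sigma> :: real
  assumes "u \<noteq> s"
  shows "1 + \<eta> * ((u * x - s * y) / (u - s)) + (- \<eta>) * ((y - x) / (u - s))
      + \<sigma> * ((u * x - s * y)\<^sup>2 / (u - s)\<^sup>2) + \<sigma> * ((y - x)\<^sup>2 / (u - s)\<^sup>2)
      - (1 - (1 - 2 * \<sigma>)) * ((y - x) * (u * x - s * y) / (u - s)\<^sup>2) =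
    1 + \<eta> * (((1 + u) * x - (1 + s) * y) / (u - s)) + \<sigma> * (((1 + u) * x - (1 + s) * y) / (u - s))\<^sup>2"
proof -
  define A where "A = (u * x - s * y) / (u - s)"
  define B where "B = (y - x) / (u - s)"
  have Q: "((1 + u) * x - (1 + s) * y) / (u - s) = A - B"
    unfolding A_def B_def diff_divide_distrib[symmetric] by (simp add: algebra_simps)
  have sq: "(u * x - s * y)\<^sup>2 / (u - s)\<^sup>2 = A\<^sup>2" "(y - x)\<^sup>2 / (u - s)\<^sup>2 = B\<^sup>2"
    "(y - x) * (u * x - s * y) / (u - s)\<^sup>2 = B * A"
    unfolding A_def B_def by (simp_all add: power_divide power2_eq_square)
  show ?thesis
    unfolding Q sq A_def[symmetric] B_def[symmetric] by (simp add: power2_eq_square algebra_simps)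
qed

text \<open>Supplies the sandwich that the conditional moments ask for: the field lies inside that
  of the outer coordinates, and it contains the two neighbouring pins, recovered by inverting the
  affine map from \<open>pin\<close> to \<open>harness_process\<close>.\<close>

lemma
  assumes stu: "0 < s" "s < t" "t < u"
  shows subalgebra_outer_field: "subalgebra lim (outer_field lim {0<..} harness_process s u)"
    and sets_outer_field_subset: "sets (outer_field lim {0<..} harness_process s u) \<subseteq>
      sets (vimage_algebra (space lim) (\<lambda>p. restrict p (outer_times (time_change s) (time_change u)))
        (PiM (outer_times (time_change s) (time_change u)) (\<lambda>_. borel)))"
    and pin_measurable_outer_field: "r \<in> {s, u} \<Longrightarrow>
      (\<lambda>p. pin p (time_change r)) \<in> borel_measurable (outer_field lim {0<..} harness_process s u)"
proof -
  let ?G = "{harness_process r -` A \<inter> space lim | r A. r \<in> {0<..} \<and> (r \<le> s \<or> r \<ge> u) \<and> A \<in> sets borel}"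
  let ?F = "outer_field lim {0<..} harness_process s u"
  have G: "?G \<subseteq> Pow (space lim)" by auto
  have sF: "sets ?F = sigma_sets (space lim) ?G"
    unfolding outer_field_def using G by (rule sets_measure_of)
  have spF: "space ?F = space lim"
    unfolding outer_field_def using G by (rule space_measure_of)
  have "?G \<subseteq> sets (outer_algebra (time_change s) (time_change u))"
  proof
    fix B assume "B \<in> ?G"
    then obtain r A where r: "r \<in> {0<..}" "r \<le> s \<or> r \<ge> u" and A: "A \<in> sets borel"
      and B: "B = harness_process r -` A \<inter> space lim" by auto
    have "time_change r \<le> time_change s \<or> time_change u \<le> time_change r"
      using r stu time_change_mono[of r s] time_change_mono[of u r] by auto
    then have "(\<lambda>p. pin p (time_change r)) \<in> borel_measurable (outer_algebra (time_change s) (time_change u))"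
      by (rule pin_measurable_outer_algebra)
    then have "harness_process r \<in> borel_measurable (outer_algebra (time_change s) (time_change u))"
      unfolding harness_process_def centred_def by simp
    from measurable_sets[OF this A]
    show "B \<in> sets (outer_algebra (time_change s) (time_change u))"
      unfolding B by (simp add: outer_algebra_def)
  qed
  then have *: "sets ?F \<subseteq> sets (outer_algebra (time_change s) (time_change u))"
    unfolding sF using sets.sigma_sets_subset[of ?G "outer_algebra (time_change s) (time_change u)"]
    by (simp add: outer_algebra_def)
  then show "sets ?F \<subseteq>
      sets (vimage_algebra (space lim) (\<lambda>p. restrict p (outer_times (time_change s) (time_change u)))
        (PiM (outer_times (time_change s) (time_change u)) (\<lambda>_. borel)))"
    by (simp only: outer_algebra_def)
  show "subalgebra lim ?F"
    using * subalgebra_outer_algebra[of "time_change s" "time_change u"] spF by (auto simp: subalgebra_def)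
  show "(\<lambda>p. pin p (time_change r)) \<in> borel_measurable ?F" if r: "r \<in> {s, u}"
  proof -
    have "harness_process r \<in> borel_measurable ?F"
    proof (rule measurableI)
      fix A assume "A \<in> sets (borel :: real measure)"
      then have "harness_process r -` A \<inter> space lim \<in> ?G"
        using r stu by (intro CollectI exI[of _ r] exI[of _ A] conjI) auto
      then show "harness_process r -` A \<inter> space ?F \<in> sets ?F"
        unfolding sF spF by (rule sigma_sets.Basic)
    qed auto
    then have "(\<lambda>p. harness_process r p / (scale * (1 + r)) + time_change r * z / T) \<in> borel_measurable ?F"
      by measurable
    moreover have "harness_process r p / (scale * (1 + r)) + time_change r * z / T = pin p (time_change r)" for p
      using r stu scale_pos by (auto simp: harness_process_def centred_def)
    ultimately show ?thesis by simp
  qed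
qed

lemma
  assumes stu: "0 < s" "s < t" "t < u"
  defines "\<sigma> \<equiv> 1 / (2 * T + 1)"
  defines "\<eta> \<equiv> - 2 * z * scale * \<sigma>"
  shows real_cond_exp_harness_process:
      "AE p in lim. real_cond_exp lim (outer_field lim {0<..} harness_process s u) (harness_process t) p =
        (u - t) / (u - s) * harness_process s p + (t - s) / (u - s) * harness_process u p"
    and cond_variance_harness_process:
      "AE p in lim. cond_variance lim (outer_field lim {0<..} harness_process s u) (harness_process t) p =
        (u - t) * (t - s) / (u * (1 + \<sigma> * s) + \<sigma> - (1 - 2 * \<sigma>) * s) *
        (1 + \<eta> * (((1 + u) * harness_process s p - (1 + s) * harness_process u p) / (u - s))
          + \<sigma> * (((1 + u) * harness_process s p - (1 + s) * harness_process u p) / (u - s))\<^sup>2)"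
proof -
  let ?F = "outer_field lim {0<..} harness_process s u"
  let ?a = "time_change s" and ?b = "time_change u" and ?t = "time_change t"
  let ?L = "\<lambda>p. bridge_mean ?a ?t ?b (pin p ?a) (pin p ?b)"
  let ?V = "\<lambda>p. bridge_var ?a ?t ?b (pin p ?a) (pin p ?b)"
  interpret F: finite_measure_subalgebra lim ?F
    using subalgebra_outer_field[OF stu] by unfold_locales
  have ab: "0 \<le> ?a" "?a < ?t" "?t < ?b" "?b \<le> T"
    using stu time_change_bounds[of s] time_change_bounds[of u] time_change_strict_mono by (auto simp: less_imp_le)
  have bm: "AE p in lim. real_cond_exp lim ?F (\<lambda>p. pin p ?t) p = ?L p"
    using ab by (rule real_cond_exp_bridge_mean)
      (use subalgebra_outer_field[OF stu] sets_outer_field_subset[OF stu] pin_measurable_outer_field[OF stu] in auto)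
  have bv: "AE p in lim. real_cond_exp lim ?F (\<lambda>p. (pin p ?t - ?L p)\<^sup>2) p = ?V p"
    using ab by (rule real_cond_exp_bridge_var)
      (use subalgebra_outer_field[OF stu] sets_outer_field_subset[OF stu] pin_measurable_outer_field[OF stu] in auto)
  have "AE p in lim. real_cond_exp lim ?F (\<lambda>p. scale * (1 + t) * (pin p ?t - ?t * z / T)) p =
      scale * (1 + t) * real_cond_exp lim ?F (\<lambda>p. pin p ?t - ?t * z / T) p"
    by (intro F.real_cond_exp_cmult Bochner_Integration.integrable_diff integrable_pin) simp
  moreover have "AE p in lim. real_cond_exp lim ?F (\<lambda>p. pin p ?t - ?t * z / T) p =
      real_cond_exp lim ?F (\<lambda>p. pin p ?t) p - real_cond_exp lim ?F (\<lambda>p. ?t * z / T) p"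
    by (intro F.real_cond_exp_diff integrable_pin) simp
  moreover have "AE p in lim. real_cond_exp lim ?F (\<lambda>p. ?t * z / T) p = ?t * z / T"
    by (rule F.real_cond_exp_F_meas) auto
  ultimately have mean: "AE p in lim. real_cond_exp lim ?F (harness_process t) p = scale * (1 + t) * (?L p - ?t * z / T)"
    using bm unfolding harness_process_def[abs_def] centred_def by eventually_elim simp
  then show "AE p in lim. real_cond_exp lim ?F (harness_process t) p =
        (u - t) / (u - s) * harness_process s p + (t - s) / (u - s) * harness_process u p"
    by (simp only: bridge_mean_harness_process[OF stu])
  have Lmeas: "?L \<in> borel_measurable lim"
    using integrable_bridge_mean by (rule borel_measurable_integrable)
  \<comment> \<open>The conditional variance is defined with an unspecified version of the
    conditional mean. It is replaced almost surely by the explicit one, so that the variance of the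
    bridge applies.\<close>
  have "AE p in lim. (harness_process t p - real_cond_exp lim ?F (harness_process t) p)\<^sup>2 = (scale * (1 + t))\<^sup>2 * (pin p ?t - ?L p)\<^sup>2"
    using mean
  proof eventually_elim
    case (elim p)
    have "harness_process t p - real_cond_exp lim ?F (harness_process t) p = scale * (1 + t) * (pin p ?t - ?L p)"
      unfolding elim by (simp add: harness_process_def centred_def algebra_simps)
    then show ?case by (simp add: power_mult_distrib)
  qed
  then have "AE p in lim. cond_variance lim ?F (harness_process t) p = real_cond_exp lim ?F (\<lambda>p. (scale * (1 + t))\<^sup>2 * (pin p ?t - ?L p)\<^sup>2) p"
    unfolding cond_variance_def
    by (rule F.real_cond_exp_cong)
      (use harness_process_measurable pin_measurable_lim Lmeas in \<open>auto intro!: borel_measurable_power borel_measurable_diff borel_measurable_times borel_measurable_cond_exp2\<close>)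
  moreover have "AE p in lim. real_cond_exp lim ?F (\<lambda>p. (scale * (1 + t))\<^sup>2 * (pin p ?t - ?L p)\<^sup>2) p =
      (scale * (1 + t))\<^sup>2 * real_cond_exp lim ?F (\<lambda>p. (pin p ?t - ?L p)\<^sup>2) p"
    by (rule F.real_cond_exp_cmult[OF integrable_pin_minus_bridge_mean])
  ultimately show "AE p in lim. cond_variance lim (outer_field lim {0<..} harness_process s u) (harness_process t) p =
        (u - t) * (t - s) / (u * (1 + \<sigma> * s) + \<sigma> - (1 - 2 * \<sigma>) * s) *
        (1 + \<eta> * (((1 + u) * harness_process s p - (1 + s) * harness_process u p) / (u - s))
          + \<sigma> * (((1 + u) * harness_process s p - (1 + s) * harness_process u p) / (u - s))\<^sup>2)"
    using bv
  proof eventually_elim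
    case (elim p)
    then show ?case
      using bridge_var_harness_process[OF stu, of p] by (simp only: \<sigma>_def \<eta>_def)
  qed
qed

lemma quadratic_harness_bridge:
  defines "\<sigma> \<equiv> 1 / (2 * T + 1)"
  defines "\<eta> \<equiv> - 2 * z * scale * \<sigma>"
  shows "quadratic_harness lim {0<..} harness_process \<eta> (- \<eta>) \<sigma> \<sigma> (1 - 2 * \<sigma>)"
proof (intro quadratic_harness.intro quadratic_harness_axioms.intro)
  show "prob_space lim" by (rule P.prob_space_axioms)
  show "open {0 :: real<..}" "is_interval {0 :: real<..}" "{0 :: real<..} \<noteq> {}" "{0 :: real<..} \<subseteq> {0<..}"
    by (auto simp: is_interval_def)
  show "harness_process t \<in> borel_measurable lim" if "t \<in> {0<..}" for t
    by (rule harness_process_measurable)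
  have "integrable lim (\<lambda>p. (scale * (1 + t))\<^sup>2 * (centred (time_change t) p * centred (time_change t) p))" for t
    by (intro integrable_mult_right integrable_centred_mult)
  then show "integrable lim (\<lambda>p. (harness_process t p)\<^sup>2)" if "t \<in> {0<..}" for t
    by (simp add: harness_process_def power2_eq_square mult_ac)
  show "P.expectation (harness_process t) = 0" if "t \<in> {0<..}" for t
    using that time_change_bounds[of t] by (simp add: harness_process_def[abs_def] expectation_centred)
  show "P.expectation (\<lambda>p. harness_process t p * harness_process s p) = min t s" if "s \<in> {0<..}" "t \<in> {0<..}" for s t
    using that covariance_harness_process[of s t] covariance_harness_process[of t s]
    by (cases "s \<le> t") (auto simp: mult.commute min_def)
  fix s t u :: real assume "s \<in> {0<..}" "t \<in> {0<..}" "u \<in> {0<..}" "s < t" "t < u"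
  then have stu: "0 < s" "s < t" "t < u" by auto
  then have us: "u \<noteq> s" by simp
  show "AE p in lim. real_cond_exp lim (outer_field lim {0<..} harness_process s u) (harness_process t) p =
        (u - t) / (u - s) * harness_process s p + (t - s) / (u - s) * harness_process u p"
    by (rule real_cond_exp_harness_process[OF stu])
  show "AE p in lim. cond_variance lim (outer_field lim {0<..} harness_process s u) (harness_process t) p =
        (u - t) * (t - s) / (u * (1 + \<sigma> * s) + \<sigma> - (1 - 2 * \<sigma>) * s) *
        (1 + \<eta> * ((u * harness_process s p - s * harness_process u p) / (u - s))
           + (- \<eta>) * ((harness_process u p - harness_process s p) / (u - s))
           + \<sigma> * ((u * harness_process s p - s * harness_process u p)\<^sup>2 / (u - s)\<^sup>2)
           + \<sigma> * ((harness_process u p - harness_process s p)\<^sup>2 / (u - s)\<^sup>2)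
           - (1 - (1 - 2 * \<sigma>)) * ((harness_process u p - harness_process s p) * (u * harness_process s p - s * harness_process u p) / (u - s)\<^sup>2))"
    unfolding quadratic_form_identity[OF us] \<sigma>_def \<eta>_def by (rule cond_variance_harness_process[OF stu])
qed

end

section \<open>Choice of the horizon and the end point\<close>

theorem proposition4p2:
  fixes \<sigma> \<eta> \<theta> \<tau> \<gamma> :: real
  assumes "\<sigma> \<in> {0<..<1}"
    and "\<eta> \<in> {- 2 * sqrt \<sigma><..<2 * sqrt \<sigma>}"
    and "\<theta> = - \<eta>" and "\<tau> = \<sigma>" and "\<gamma> = 1 - 2 * \<sigma>"
  shows "\<exists>(M :: (real \<Rightarrow> real) measure) X. quadratic_harness M {0<..} X \<eta> \<theta> \<sigma> \<tau> \<gamma>"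
proof -
  \<comment> \<open>\<open>T\<close> solves \<open>1 / (2 * T + 1) = \<sigma>\<close>, and
    \<open>z\<close> solves \<open>- z / sqrt (T\<^sup>2 + z\<^sup>2) = k\<close>. The bound on
    \<eta> says that k lies in (-1, 1), which is what makes the second equation solvable.\<close>
  define T where "T = (1 - \<sigma>) / (2 * \<sigma>)"
  define k where "k = \<eta> / (2 * sqrt \<sigma>)"
  define z where "z = - T * k / sqrt (1 - k\<^sup>2)"
  have \<sigma>: "0 < \<sigma>" "\<sigma> < 1" using assms(1) by auto
  have T: "T > 0" using \<sigma> by (simp add: T_def)
  interpret meixner_bridge T z using T by unfold_locales
  have "\<bar>k\<bar> < 1" using assms(2) \<sigma> by (auto simp: k_def abs_less_iff field_simps)
  then have k: "1 - k\<^sup>2 > 0" by (simp add: abs_square_less_1)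
  have s: "1 / (2 * T + 1) = \<sigma>" using \<sigma> by (simp add: T_def field_simps)
  have s': "2 * T + 1 = 1 / \<sigma>" unfolding s[symmetric] by simp
  have "z\<^sup>2 = T\<^sup>2 * k\<^sup>2 / (1 - k\<^sup>2)"
    using k by (simp add: z_def power_divide power_mult_distrib)
  then have "T\<^sup>2 + z\<^sup>2 = T\<^sup>2 / (1 - k\<^sup>2)"
    using k by (simp add: field_simps)
  then have "scale = sqrt ((1 - k\<^sup>2) / (\<sigma> * T\<^sup>2))"
    unfolding scale_def s' by (simp add: field_simps)
  also have "\<dots> = sqrt (1 - k\<^sup>2) / (sqrt \<sigma> * T)"
    using T by (simp add: real_sqrt_divide real_sqrt_mult)
  finally have "- 2 * z * scale * \<sigma> = 2 * k * (\<sigma> / sqrt \<sigma>)"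
    unfolding z_def using T k by (simp add: field_simps)
  also have "\<dots> = \<eta>"
    using \<sigma> by (simp add: k_def real_div_sqrt)
  finally show ?thesis
    using quadratic_harness_bridge assms(3-5) unfolding s by auto
qed

end
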